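(* Let $m\ge1$ be an integer and let $\{x_j\}$ be a non-decreasing sequence of real knots (indexed by consecutive integers) with $0<x_{j+m}-x_j<\frac{2\pi h}{\ln(1+h)}$ for all $j$. Let $(x_k,x_r)$ be any nonempty interval, with $x_k,x_r$ knots, such that at least $m$ of the values $x_j$ satisfy $x_j\le x_k$ and at least $m$ of the values $x_j$ satisfy $x_j\ge x_r$. Then for $x\in(x_k,x_r)$ and $y\in\mathbb{R}$, $$\left(\sin_h\frac{y-x}{2}\right)_h^{m-1}=\sum_j\tilde T_{j,m}(x;h)\prod_{l=1}^{m-1}\sin_h\left(\frac{y-x_{j+l}}{2}\right).$$
   Context: Fix a real number $h\neq 0$, $h>-1$. For real $x$ put $e_h^{ix}=(1+h)^{ix/h}=\exp\left(ix\frac{\ln(1+h)}{h}\right)$, $\cos_h x=\frac{e_h^{ix}+e_h^{-ix}}{2}$, $\sin_h x=\frac{e_h^{ix}-e_h^{-ix}}{2i}$. For functions $\varphi_0,\dots,\varphi_m$ and points $x_0,\dots,x_m$, $\det\begin{pmatrix}\varphi_0&\cdots&\varphi_m\\ x_0&\cdots&x_m\end{pmatrix}$ denotes the determinant of the matrix whose row $r$ is $(\varphi_0(x_r),\dots,\varphi_m(x_r))$, $r=0,\dots,m$. $h$-trigonometric divided difference: for $m\ge1$, $x_0<\cdots<x_m$ with $x_m-x_0<\frac{2\pi h}{\ln(1+h)}$ and a function $f$ defined at the nodes, $$[x_0,\ldots,x_m;h]_t f=2^{m-1}\frac{\det\begin{pmatrix}1&\cos_h x&\sin_h x&\cdots&\cos_h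 nx&\sin_h nx&f(x)\\ x_0&x_1&x_2&\cdots&x_{m-2}&x_{m-1}&x_m\end{pmatrix}}{\det\begin{pmatrix}\cos_h\frac x2&\sin_h\frac x2&\cdots&\cos_h(n+\frac12)x&\sin_h(n+\frac12)x\\ x_0&x_1&\cdots&x_{m-1}&x_m\end{pmatrix}}\quad\text{if } m=2n+1,$$ $$[x_0,\ldots,x_m;h]_t f=2^{m}\frac{\det\begin{pmatrix}\cos_h\frac x2&\sin_h\frac x2&\cdots&\cos_h(n-\frac12)x&\sin_h(n-\frac12)x&f(x)\\ x_0&x_1&\cdots&x_{m-2}&x_{m-1}&x_m\end{pmatrix}}{\det\begin{pmatrix}1&\cos_h x&\sin_h x&\cdots&\cos_h nx&\sin_h nx\\ x_0&x_1&x_2&\cdots&x_{m-1}&x_m\end{pmatrix}}\quad\text{if } m=2n.$$ If some (not all) of the nodes coincide, the divided difference is read as the limit of its values at distinct nodes that approach the given ones from the left. $h$-power: $\left(\sin_h\frac{y-x}{2}\right)_h^{m-1}=\prod_{l=0}^{m-2}\sin_h\left(\frac{y-(x-lh)}{2}\right)$, equal to $1$ for $m=1$. $h$-truncated power: $\left(\sin_h\frac{y-x}{2}\right)_+^{m-1}=\left(\sin_h\frac{y-x}{2}\right)_h^{m-1}$ if $y>x$, and $0$ if $y\le x$. $h$-trigonometric B-splines: for $m\ge1$, $T_{j,m}(x;h)\equiv0$ if $x_{j+m}=x_j$, and if $x_{j+m}>x_j$, $T_{j,m}(x;h)=[x_j,\ldots,x_{j+m};h]_t\left(\sin_h\frac{y-x}{2}\right)_+^{m-1}$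 (divided difference with respect to $y$). Further, $\tilde T_{j,m}(x;h)=\sin_h\left(\frac{x_{j+m}-x_j}{2}\right)T_{j,m}(x;h)$. The sum over $j$ runs over all indices for which $x_j,\dots,x_{j+m}$ are knots. *)

theory Defs
  imports
    "HOL-Analysis.Function_Topology"
    "HOL-Analysis.Infinite_Sum"
    "HOL-Analysis.Complex_Transcendental"
    "Jordan_Normal_Form.Determinant"
begin

definition hexp :: "real \<Rightarrow> real \<Rightarrow> complex" where
  "hexp h x = exp (\<i> * of_real x * of_real (ln (1 + h) / h))"

definition hcos :: "real \<Rightarrow> real \<Rightarrow> complex" where
  "hcos h x = (hexp h x + hexp h (- x)) / 2"

definition hsin :: "real \<Rightarrow> real \<Rightarrow> complex" where
  "hsin h x = (hexp h x - hexp h (- x)) / (2 * \<i>)"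

lemma hexp_eq_powr:
  assumes "h > -1"
  shows "hexp h x = of_real (1 + h) powr (\<i> * of_real x / of_real h)"
proof -
  have "of_real (1 + h) \<noteq> (0::complex)"
    using assms by (metis of_real_eq_0_iff add.commute less_irrefl neg_less_iff_less add_eq_0_iff)
  moreover have "Ln (of_real (1 + h)) = of_real (ln (1 + h))"
    using assms by (intro Ln_of_real) simp
  ultimately show ?thesis
    by (simp add: hexp_def powr_def mult.commute mult.left_commute)
qed

lemma hcos_eq: "hcos h x = of_real (cos (x * (ln (1 + h) / h)))"
  by (simp add: hcos_def hexp_def cos_of_real[symmetric] cos_exp_eq mult.assoc)

lemma hsin_eq: "hsin h x = of_real (sin (x * (ln (1 + h) / h)))"
  by (simp add: hsin_def hexp_def sin_of_real[symmetric] sin_exp_eq mult.assoc)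

definition sysdet :: "nat \<Rightarrow> (nat \<Rightarrow> real \<Rightarrow> complex) \<Rightarrow> (nat \<Rightarrow> real) \<Rightarrow> complex" where
  "sysdet m \<phi> t = det (mat (m + 1) (m + 1) (\<lambda>(r, c). \<phi> c (t r)))"

text \<open>The sequence of functions
  \<open>1, cos\<^sub>h x, sin\<^sub>h x, cos\<^sub>h 2x, sin\<^sub>h 2x, \<dots>\<close>.\<close>

definition int_sys :: "real \<Rightarrow> nat \<Rightarrow> real \<Rightarrow> complex" where
  "int_sys h c x =
     (if c = 0 then 1
      else if odd c then hcos h (real ((c + 1) div 2) * x)
      else hsin h (real (c div 2) * x))"

text \<open>The sequence of functions
  \<open>cos\<^sub>h (x/2), sin\<^sub>h (x/2), cos\<^sub>h (3x/2), sin\<^sub>h (3x/2), \<dots>\<close>.\<close>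

definition half_sys :: "real \<Rightarrow> nat \<Rightarrow> real \<Rightarrow> complex" where
  "half_sys h c x =
     (if even c then hcos h ((real (c div 2) + 1 / 2) * x)
      else hsin h ((real (c div 2) + 1 / 2) * x))"

text \<open>Both divided differences below use the nodes \<open>t 0, \<dots>, t m\<close> only. The update
  \<open>(int_sys h)(m := f)\<close> puts \<open>f\<close> in the last column of the numerator.\<close>

definition divdiff_distinct ::
  "nat \<Rightarrow> (nat \<Rightarrow> real) \<Rightarrow> real \<Rightarrow> (real \<Rightarrow> complex) \<Rightarrow> complex" where
  "divdiff_distinct m t h f =
     (if odd m
      then 2 ^ (m - 1) * sysdet m ((int_sys h)(m := f)) t / sysdet m (half_sys h) t
      else 2 ^ m * sysdet m ((half_sys h)(m := f)) t / sysdet m (int_sys h) t)"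

text \<open>For coinciding nodes the limit is taken over strictly increasing nodes \<open>s\<close> that tend to
  \<open>t\<close> (pointwise, i.e. in the product topology) with \<open>s i \<le> t i\<close>. Coordinates beyond \<open>m\<close> do
  not influence the value. The spread condition \<open>s m - s 0 < 2 \<pi> h / ln (1 + h)\<close> is open, so it
  holds near \<open>t\<close> as soon as it holds for \<open>t\<close>.\<close>

definition divdiff ::
  "nat \<Rightarrow> (nat \<Rightarrow> real) \<Rightarrow> real \<Rightarrow> (real \<Rightarrow> complex) \<Rightarrow> complex" where
  "divdiff m t h f =
     (if strict_mono_on {..m} t then divdiff_distinct m t h f
      else Lim (at t within {s. strict_mono_on {..m} s \<and> (\<forall>i\<le>m. s i \<le> t i)})
             (\<lambda>s. divdiff_distinct m s h f))"

text \<open>\<open>hsin_power h p x y\<close> is the \<open>h\<close>-power of \<open>sin\<^sub>h ((y - x) / 2)\<close> with exponent \<open>p\<close>, that is,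
  \<open>p = m - 1\<close> for splines of order \<open>m\<close>.\<close>

definition hsin_power :: "real \<Rightarrow> nat \<Rightarrow> real \<Rightarrow> real \<Rightarrow> complex" where
  "hsin_power h p x y = (\<Prod>l<p. hsin h ((y - (x - real l * h)) / 2))"

definition hsin_trunc_power :: "real \<Rightarrow> nat \<Rightarrow> real \<Rightarrow> real \<Rightarrow> complex" where
  "hsin_trunc_power h p x y = (if y > x then hsin_power h p x y else 0)"

definition T_spline :: "(int \<Rightarrow> real) \<Rightarrow> int \<Rightarrow> nat \<Rightarrow> real \<Rightarrow> real \<Rightarrow> complex" where
  "T_spline \<xi> j m x h =
     (if \<xi> (j + int m) = \<xi> j then 0
      else divdiff m (\<lambda>i. \<xi> (j + int i)) h (\<lambda>y. hsin_trunc_power h (m - 1) x y))"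

definition T_spline_normalized :: "(int \<Rightarrow> real) \<Rightarrow> int \<Rightarrow> nat \<Rightarrow> real \<Rightarrow> real \<Rightarrow> complex" where
  "T_spline_normalized \<xi> j m x h =
     hsin h ((\<xi> (j + int m) - \<xi> j) / 2) * T_spline \<xi> j m x h"

end

theory Submission
  imports Defs
begin

text \<open>The identity is a telescoping sum. The substitution \<open>z = hexp h s\<close> turns products of factors
  \<open>hsin h ((a - b) / 2)\<close> into products of differences \<open>z\<^sub>a - z\<^sub>b\<close>, up to half-integer powers of the
  \<open>z\<close>'s. In this variable the trigonometric divided difference of order \<open>m\<close> is, up to an explicit
  factor, the ordinary divided difference of \<open>f(s) z\<^sup>(\<^sup>m\<^sup>-\<^sup>1\<^sup>)\<^sup>/\<^sup>2\<close>, that is, the leading coefficient of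
  a Lagrange interpolant (\<open>divdiff_distinct_eq_ddiff\<close>): both determinants in its definition are a
  Vandermonde-type determinant times a constant one, and the powers of \<open>2\<close> in the definition are
  just what makes the constants combine to \<open>(2 \<i>)\<^sup>m\<close>.

  Let \<open>L\<^sub>j\<close> be the interpolant of degree less than \<open>m\<close> at the nodes \<open>x\<^sub>j, \<dots>, x\<^sub>j\<^sub>+\<^sub>m\<^sub>-\<^sub>1\<close>. Two consecutive
  ones agree at \<open>x\<^sub>j\<^sub>+\<^sub>1, \<dots>, x\<^sub>j\<^sub>+\<^sub>m\<^sub>-\<^sub>1\<close>, so \<open>L\<^sub>j\<^sub>+\<^sub>1 - L\<^sub>j\<close> is a divided difference times the product over
  these nodes (\<open>lagrange_exchange\<close>). Translated back, this is the \<open>j\<close>-th summand of the theorem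
  (\<open>divdiff_distinct_telescopes\<close>). The interpolated function is the weighted truncated power. If \<open>x\<close> lies
  between the knots \<open>x\<^sub>p\<close> and \<open>x\<^sub>p\<^sub>+\<^sub>1\<close>, then it vanishes at the \<open>m\<close> knots ending with \<open>x\<^sub>p\<close>, and at the \<open>m\<close>
  knots starting with \<open>x\<^sub>p\<^sub>+\<^sub>1\<close> it coincides with the full \<open>h\<close>-power, which, multiplied by
  \<open>z\<^sup>(\<^sup>m\<^sup>-\<^sup>1\<^sup>)\<^sup>/\<^sup>2\<close>, is a polynomial of degree at most \<open>m - 1\<close> in \<open>z\<close>. So the first
  interpolant is \<open>0\<close>, the last one is this polynomial, and the sum is their difference, up to the
  weight at \<open>y\<close>.

  Repeated knots are reached by a limit. Lowering the knots slightly makes them distinct, and a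
  knot at \<open>x\<close>, where the truncated power is zero, only moves to points where it is zero
  as well. It remains to know that the limits defining the splines exist. Nodes on the two sides of \<open>x\<close> stay apart, so the divided
  difference can be reduced by its recursion to divided differences over one side only, and there
  the function is a polynomial (\<open>ddiff_tendsto_ex\<close>).\<close>

section \<open>Lagrange interpolation and divided differences\<close>

definition ddiff :: "('i \<Rightarrow> 'a::field) \<Rightarrow> 'i set \<Rightarrow> ('i \<Rightarrow> 'a) \<Rightarrow> 'a" where
  "ddiff z I g = (\<Sum>i\<in>I. g i / (\<Prod>k\<in>I - {i}. z i - z k))"

definition lagrange :: "('i \<Rightarrow> 'a::field) \<Rightarrow> 'i set \<Rightarrow> ('i \<Rightarrow> 'a) \<Rightarrow> 'a poly" where
  "lagrange z I g =
     (\<Sum>i\<in>I. smult (g i / (\<Prod>k\<in>I - {i}. z i - z k)) (\<Prod>k\<in>I - {i}. [:- z k, 1:]))"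

lemma poly_lagrange:
  "poly (lagrange z I g) u =
     (\<Sum>i\<in>I. g i / (\<Prod>k\<in>I - {i}. z i - z k) * (\<Prod>k\<in>I - {i}. u - z k))"
  by (simp add: lagrange_def poly_sum poly_prod)

lemma degree_lagrange_less:
  assumes "finite I" "I \<noteq> {}"
  shows "degree (lagrange z I g) < card I"
proof -
  have "degree (\<Prod>k\<in>I - {i}. [:- z k, 1:]) \<le> card I - 1" if "i \<in> I" for i
    by (subst degree_prod_eq_sum_degree) (use that assms in auto)
  then have "degree (lagrange z I g) \<le> card I - 1"
    unfolding lagrange_def using assms
    by (intro degree_sum_le) (auto intro: order_trans[OF degree_smult_le])
  moreover have "card I > 0" using assms by (simp add: card_gt_0_iff)
  ultimately show ?thesis by simp
qed

lemma coeff_prod_linear: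
  fixes z :: "'i \<Rightarrow> 'a::field"
  assumes "finite I"
  shows "coeff (\<Prod>k\<in>I. [:- z k, 1:]) (card I) = 1"
proof -
  have "degree (\<Prod>k\<in>I. [:- z k, 1:]) = card I"
    by (subst degree_prod_eq_sum_degree) auto
  moreover have "lead_coeff (\<Prod>k\<in>I. [:- z k, 1:]) = 1"
    by (simp add: lead_coeff_prod)
  ultimately show ?thesis by simp
qed

lemma coeff_lagrange:
  assumes "finite I"
  shows "coeff (lagrange z I g) (card I - 1) = ddiff z I g"
proof -
  have "coeff (\<Prod>k\<in>I - {i}. [:- z k, 1:]) (card I - 1) = 1" if "i \<in> I" for i
    using coeff_prod_linear[of "I - {i}" z] assms that by simp
  then show ?thesis by (simp add: lagrange_def ddiff_def coeff_sum)
qed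

lemma poly_lagrange_node:
  assumes "finite I" "inj_on z I" "i \<in> I"
  shows "poly (lagrange z I g) (z i) = g i"
proof -
  have "(\<Prod>k\<in>I - {j}. z i - z k) = 0" if "j \<in> I" "j \<noteq> i" for j
    using assms that by (auto simp: prod_zero_iff)
  moreover have "(\<Prod>k\<in>I - {i}. z i - z k) \<noteq> 0"
    using assms by (auto simp: prod_zero_iff dest: inj_onD)
  ultimately have "poly (lagrange z I g) (z i) = (\<Sum>j\<in>I. if j = i then g i else 0)"
    unfolding poly_lagrange by (intro sum.cong) auto
  then show ?thesis using assms by simp
qed

lemma lagrange_unique:
  assumes "finite I" "inj_on z I" "degree Q < card I" "\<And>i. i \<in> I \<Longrightarrow> g i = poly Q (z i)"
  shows "lagrange z I g = Q"
proof -
  have "I \<noteq> {}" using assms by auto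
  then show ?thesis
    using assms degree_lagrange_less[of I z g]
    by (intro poly_eqI_degree[of "z ` I"]) (auto simp: poly_lagrange_node card_image)
qed

lemma ddiff_poly:
  assumes "finite I" "inj_on z I" "degree Q < card I" "\<And>i. i \<in> I \<Longrightarrow> g i = poly Q (z i)"
  shows "ddiff z I g = coeff Q (card I - 1)"
  using lagrange_unique[OF assms] coeff_lagrange[OF assms(1), of z g] by simp

text \<open>Both interpolants take the same values on \<open>M\<close>, so their difference is a multiple of the product
  over \<open>M\<close>. This is the step that makes the sum in Marsden's identity telescope.\<close>

lemma lagrange_exchange:
  assumes "finite M" "a \<notin> M" "b \<notin> M" "a \<noteq> b" "inj_on z (insert a (insert b M))"
  shows "poly (lagrange z (insert b M) g) u - poly (lagrange z (insert a M) g) u =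
           (z b - z a) * ddiff z (insert a (insert b M)) g * (\<Prod>k\<in>M. u - z k)"
proof -
  define w where "w i = (\<Prod>k\<in>M - {i}. z i - z k)" for i
  define v where "v i = (\<Prod>k\<in>M - {i}. u - z k)" for i
  have ne: "z a \<noteq> z b" "\<And>i. i \<in> M \<Longrightarrow> z i \<noteq> z a" "\<And>i. i \<in> M \<Longrightarrow> z i \<noteq> z b"
    using assms(2-5) unfolding inj_on_def by blast+
  have w0: "w i \<noteq> 0" if "i \<in> insert a (insert b M)" for i
    using assms that unfolding w_def by (auto simp: prod_zero_iff dest: inj_onD)
  have sets: "insert a (insert b M) - {a} = insert b M" "insert a (insert b M) - {b} = insert a M"
    "insert a M - {a} = M" "insert b M - {b} = M" "M - {a} = M" "M - {b} = M"
    using assms by auto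
  have setsM: "insert a (insert b M) - {i} = insert a (insert b (M - {i}))"
    "insert a M - {i} = insert a (M - {i})" "insert b M - {i} = insert b (M - {i})"
    if "i \<in> M" for i using assms that by auto
  have v: "(u - z i) * v i = (\<Prod>k\<in>M. u - z k)" if "i \<in> M" for i
    using assms(1) that unfolding v_def by (simp add: prod.remove[of M i])
  have ab: "ddiff z (insert a (insert b M)) g = g a / ((z a - z b) * w a) + g b / ((z b - z a) * w b)
     + (\<Sum>i\<in>M. g i / ((z i - z a) * ((z i - z b) * w i)))"
    unfolding ddiff_def using assms(1-4)
    by (simp add: sets setsM w_def)
  have b: "poly (lagrange z (insert b M) g) u = g b / w b * (\<Prod>k\<in>M. u - z k)
      + (\<Sum>i\<in>M. g i / ((z i - z b) * w i) * ((u - z b) * v i))"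
    unfolding poly_lagrange using assms(1-4)
    by (simp add: sets setsM w_def v_def)
  have a: "poly (lagrange z (insert a M) g) u = g a / w a * (\<Prod>k\<in>M. u - z k)
      + (\<Sum>i\<in>M. g i / ((z i - z a) * w i) * ((u - z a) * v i))"
    unfolding poly_lagrange using assms(1-4)
    by (simp add: sets setsM w_def v_def)
  have eM: "(z b - z a) * (\<Sum>i\<in>M. g i / ((z i - z a) * ((z i - z b) * w i))) * (\<Prod>k\<in>M. u - z k) =
      (\<Sum>i\<in>M. g i / ((z i - z b) * w i) * ((u - z b) * v i)
             - g i / ((z i - z a) * w i) * ((u - z a) * v i))"
    unfolding sum_distrib_left sum_distrib_right
  proof (rule sum.cong)
    fix i assume i: "i \<in> M"
    then have "z i - z a \<noteq> 0" "z i - z b \<noteq> 0" "w i \<noteq> 0" using ne w0 by auto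
    then show "(z b - z a) * (g i / ((z i - z a) * ((z i - z b) * w i))) * (\<Prod>k\<in>M. u - z k) =
         g i / ((z i - z b) * w i) * ((u - z b) * v i) - g i / ((z i - z a) * w i) * ((u - z a) * v i)"
      unfolding v[OF i, symmetric] by (simp add: divide_simps) (simp add: algebra_simps)
  qed simp
  have ea: "(z b - z a) * (g a / ((z a - z b) * w a)) = - (g a / w a)"
  proof -
    have "(z b - z a) / (z a - z b) = - 1" using ne(1) by (simp add: divide_simps)
    then have "(z b - z a) / (z a - z b) * (g a / w a) = - (g a / w a)" by simp
    then show ?thesis by simp
  qed
  have eb: "(z b - z a) * (g b / ((z b - z a) * w b)) = g b / w b"
    using ne(1) by simp
  show ?thesis
    unfolding ab a b distrib_left distrib_right ea eb eM sum_subtractf by simp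
qed

text \<open>Comparing leading coefficients in the exchange identity gives the usual recursion. Because the
  two nodes to be dropped may be chosen freely, it can always be applied to a pair of nodes that
  stay apart in the limit.\<close>

lemma ddiff_recursion:
  fixes z :: "'i \<Rightarrow> 'a::field_char_0"
  assumes "finite M" "a \<notin> M" "b \<notin> M" "a \<noteq> b" "inj_on z (insert a (insert b M))"
  shows "(z b - z a) * ddiff z (insert a (insert b M)) g =
           ddiff z (insert b M) g - ddiff z (insert a M) g"
proof -
  define c where "c = (z b - z a) * ddiff z (insert a (insert b M)) g"
  have "poly (lagrange z (insert b M) g - lagrange z (insert a M) g) =
      poly (smult c (\<Prod>k\<in>M. [:- z k, 1:]))"
    using lagrange_exchange[OF assms, of g] by (auto simp: poly_prod c_def)
  then have eq: "lagrange z (insert b M) g - lagrange z (insert a M) g =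
      smult c (\<Prod>k\<in>M. [:- z k, 1:])"
    by (simp only: poly_eq_poly_eq_iff)
  have "coeff (lagrange z (insert b M) g) (card M) = ddiff z (insert b M) g"
    "coeff (lagrange z (insert a M) g) (card M) = ddiff z (insert a M) g"
    using coeff_lagrange[of "insert b M" z g] coeff_lagrange[of "insert a M" z g] assms(1-3)
    by simp_all
  moreover have "coeff (\<Prod>k\<in>M. [:- z k, 1:]) (card M) = 1"
    using coeff_prod_linear[OF assms(1), of z] .
  ultimately show ?thesis
    using arg_cong[OF eq, of "\<lambda>p. coeff p (card M)"] by (simp add: c_def)
qed

text \<open>Nodes may coalesce within \<open>U\<close> and within \<open>V\<close>, but not across. Divided differences over \<open>V\<close>
  alone converge, by induction on the polynomial: \<open>Q\<close> shifted by one degree is treated with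
  \<open>z Q = (z - z\<^sub>a) Q + z\<^sub>a Q\<close>, where the factor \<open>z - z\<^sub>a\<close> cancels the node \<open>a\<close>. In general the recursion,
  applied to one node of \<open>U\<close> and one of \<open>V\<close>, divides only by a quantity with nonzero limit.\<close>

lemma ddiff_tendsto_ex:
  fixes z :: "'s \<Rightarrow> 'i \<Rightarrow> complex"
  assumes "finite U" "finite V" "U \<inter> V = {}"
    and "\<And>i. i \<in> U \<union> V \<Longrightarrow> ((\<lambda>s. z s i) \<longlongrightarrow> \<zeta> i) F"
    and "\<And>u v. u \<in> U \<Longrightarrow> v \<in> V \<Longrightarrow> \<zeta> u \<noteq> \<zeta> v"
    and "\<forall>\<^sub>F s in F. inj_on (z s) (U \<union> V)"
  shows "\<exists>l. ((\<lambda>s. ddiff (z s) (U \<union> V) (\<lambda>i. if i \<in> V then poly Q (z s i) else 0)) \<longlongrightarrow> l) F"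
proof -
  have pure: "\<exists>l. ((\<lambda>s. ddiff (z s) V (\<lambda>i. poly Q (z s i))) \<longlongrightarrow> l) F"
    if "finite V" "\<And>i. i \<in> V \<Longrightarrow> ((\<lambda>s. z s i) \<longlongrightarrow> \<zeta> i) F" "\<forall>\<^sub>F s in F. inj_on (z s) V" for V
    using that
  proof (induction Q arbitrary: V)
    case 0
    then show ?case by (auto simp: ddiff_def)
  next
    case (pCons c Q)
    show ?case
    proof (cases "V = {}")
      case True
      then show ?thesis by (auto simp: ddiff_def)
    next
      case False
      then obtain a where a: "a \<in> V" by blast
      obtain l1 where l1: "((\<lambda>s. ddiff (z s) V (\<lambda>i. poly Q (z s i))) \<longlongrightarrow> l1) F"
        using pCons.IH[of V] pCons.prems by blast
      have "\<forall>\<^sub>F s in F. inj_on (z s) (V - {a})"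
        using pCons.prems(3) by eventually_elim (auto intro: inj_on_diff)
      then obtain l2 where l2: "((\<lambda>s. ddiff (z s) (V - {a}) (\<lambda>i. poly Q (z s i))) \<longlongrightarrow> l2) F"
        using pCons.IH[of "V - {a}"] pCons.prems by blast
      \<comment> \<open>The divided difference over \<open>V\<close> of the constant \<open>c\<close>: it is \<open>c\<close> for a single node and \<open>0\<close> otherwise.\<close>
      define e where "e = c * coeff 1 (card V - 1)"
      have "\<forall>\<^sub>F s in F. e + (z s a * ddiff (z s) V (\<lambda>i. poly Q (z s i))
                 + ddiff (z s) (V - {a}) (\<lambda>i. poly Q (z s i)))
               = ddiff (z s) V (\<lambda>i. poly (pCons c Q) (z s i))"
        using pCons.prems(3)
      proof eventually_elim
        case (elim s)
        have "ddiff (z s) V (\<lambda>i. 1) = coeff 1 (card V - 1)"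
          using elim pCons.prems(1) False by (intro ddiff_poly) (auto simp: card_gt_0_iff)
        moreover have "ddiff (z s) V (\<lambda>i. c) = c * ddiff (z s) V (\<lambda>i. 1)"
          by (simp add: ddiff_def sum_distrib_left)
        ultimately have e: "ddiff (z s) V (\<lambda>i. c) = e" by (simp add: e_def)
        have "ddiff (z s) V (\<lambda>i. (z s i - z s a) * poly Q (z s i)) =
              ddiff (z s) (V - {a}) (\<lambda>i. poly Q (z s i))"
        proof -
          have "(z s i - z s a) * poly Q (z s i) / (\<Prod>k\<in>V - {i}. z s i - z s k) =
                poly Q (z s i) / (\<Prod>k\<in>V - {a} - {i}. z s i - z s k)" if "i \<in> V - {a}" for i
          proof -
            have "V - {a} - {i} = (V - {i}) - {a}" by auto
            moreover have "z s i \<noteq> z s a" using elim a that by (auto dest: inj_onD)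
            ultimately show ?thesis
              using that a pCons.prems(1) by (subst prod.remove[of _ a]) auto
          qed
          then show ?thesis
            unfolding ddiff_def using a pCons.prems(1) by (subst sum.remove[of V a]) auto
        qed
        moreover have "ddiff (z s) V (\<lambda>i. poly (pCons c Q) (z s i)) =
            ddiff (z s) V (\<lambda>i. c) + (z s a * ddiff (z s) V (\<lambda>i. poly Q (z s i))
             + ddiff (z s) V (\<lambda>i. (z s i - z s a) * poly Q (z s i)))"
          unfolding ddiff_def sum_distrib_left sum.distrib[symmetric]
          by (intro sum.cong refl) (simp add: algebra_simps add_divide_distrib diff_divide_distrib)
        ultimately show ?case using e by simp
      qed
      moreover have "((\<lambda>s. e + (z s a * ddiff (z s) V (\<lambda>i. poly Q (z s i))
                 + ddiff (z s) (V - {a}) (\<lambda>i. poly Q (z s i)))) \<longlongrightarrow> e + (\<zeta> a * l1 + l2)) F"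
        by (intro tendsto_intros l1 l2 pCons.prems(2) a)
      ultimately show ?thesis by - (rule exI, rule Lim_transform_eventually)
    qed
  qed
  show ?thesis
    using assms
  proof (induction "card U + card V" arbitrary: U V rule: less_induct)
    case less
    show ?case
    proof (cases "U = {} \<or> V = {}")
      case True
      then show ?thesis
      proof
        assume "U = {}"
        moreover have "ddiff (z s) V (\<lambda>i. if i \<in> V then poly Q (z s i) else 0) =
            ddiff (z s) V (\<lambda>i. poly Q (z s i))" for s
          by (auto simp: ddiff_def)
        ultimately show ?thesis using pure[of V] less.prems by simp
      qed (auto simp: ddiff_def)
    next
      case False
      then obtain a b where ab: "a \<in> U" "b \<in> V" by blast
      let ?g = "\<lambda>W s i. if i \<in> W then poly Q (z s i) else 0"
      have ca: "card (U - {a}) < card U" "card (V - {b}) < card V"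
        using ab less.prems(1,2) by (meson card_Diff1_less)+
      have "\<exists>l. ((\<lambda>s. ddiff (z s) ((U - {a}) \<union> V) (?g V s)) \<longlongrightarrow> l) F"
      proof (rule less.hyps)
        show "\<forall>\<^sub>F s in F. inj_on (z s) (U - {a} \<union> V)"
          using less.prems(6) by eventually_elim (auto elim: inj_on_subset)
      qed (use ca less.prems in auto)
      then obtain l1 where l1: "((\<lambda>s. ddiff (z s) ((U - {a}) \<union> V) (?g V s)) \<longlongrightarrow> l1) F" ..
      have "\<exists>l. ((\<lambda>s. ddiff (z s) (U \<union> (V - {b})) (?g (V - {b}) s)) \<longlongrightarrow> l) F"
      proof (rule less.hyps)
        show "\<forall>\<^sub>F s in F. inj_on (z s) (U \<union> (V - {b}))"
          using less.prems(6) by eventually_elim (auto elim: inj_on_subset)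
      qed (use ca less.prems in auto)
      then obtain l2 where l2: "((\<lambda>s. ddiff (z s) (U \<union> (V - {b})) (?g (V - {b}) s)) \<longlongrightarrow> l2) F" ..
      have l2': "((\<lambda>s. ddiff (z s) (U \<union> (V - {b})) (?g V s)) \<longlongrightarrow> l2) F"
      proof -
        have "ddiff (z s) (U \<union> (V - {b})) (?g (V - {b}) s) = ddiff (z s) (U \<union> (V - {b})) (?g V s)" for s
          unfolding ddiff_def using ab less.prems(3) by (intro sum.cong refl) auto
        then show ?thesis using l2 by simp
      qed
      define M where "M = (U - {a}) \<union> (V - {b})"
      have M: "(U - {a}) \<union> V = insert b M" "U \<union> (V - {b}) = insert a M"
        "U \<union> V = insert a (insert b M)" "finite M" "a \<notin> M" "b \<notin> M" "a \<noteq> b"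
        using ab less.prems by (auto simp: M_def)
      have "\<forall>\<^sub>F s in F. (ddiff (z s) ((U - {a}) \<union> V) (?g V s)
              - ddiff (z s) (U \<union> (V - {b})) (?g V s)) / (z s b - z s a)
            = ddiff (z s) (U \<union> V) (?g V s)"
        using less.prems(6)
      proof eventually_elim
        case (elim s)
        have "z s b \<noteq> z s a" using elim M ab by (auto dest!: inj_onD)
        moreover have "(z s b - z s a) * ddiff (z s) (U \<union> V) (?g V s) =
           ddiff (z s) ((U - {a}) \<union> V) (?g V s) - ddiff (z s) (U \<union> (V - {b})) (?g V s)"
          unfolding M(1-3) using elim M by (intro ddiff_recursion) auto
        ultimately show ?case by (simp add: field_simps)
      qed
      moreover have "((\<lambda>s. (ddiff (z s) ((U - {a}) \<union> V) (?g V s)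
              - ddiff (z s) (U \<union> (V - {b})) (?g V s)) / (z s b - z s a))
              \<longlongrightarrow> (l1 - l2) / (\<zeta> b - \<zeta> a)) F"
        using ab less.prems(4) less.prems(5)[OF ab] by (intro tendsto_intros l1 l2') auto
      ultimately show ?thesis by - (rule exI, rule Lim_transform_eventually)
    qed
  qed
qed

section \<open>Vandermonde and trigonometric coefficient determinants\<close>

lemma det_vandermonde_nonzero:
  fixes z :: "nat \<Rightarrow> 'a::field"
  assumes "inj_on z {..<n}"
  shows "det (mat n n (\<lambda>(r, c). z r ^ c)) \<noteq> 0"
proof
  let ?V = "mat n n (\<lambda>(r, c). z r ^ c)"
  assume "det ?V = 0"
  then obtain v where v: "v \<in> carrier_vec n" "v \<noteq> 0\<^sub>v n" "?V *\<^sub>v v = 0\<^sub>v n"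
    using det_0_iff_vec_prod_zero[of ?V n] by auto
  define p where "p = (\<Sum>e<n. monom (v $ e) e)"
  have coeff_p: "coeff p e = (if e < n then v $ e else 0)" for e
    by (simp add: p_def coeff_sum)
  have "n > 0"
    using v(1,2) by (cases n) auto
  have "degree p < n"
    using \<open>n > 0\<close> by (intro degree_lessI) (auto simp: coeff_p)
  moreover have "poly p (z r) = 0" if "r < n" for r
  proof -
    have "poly p (z r) = (?V *\<^sub>v v) $ r"
      using that v(1) by (simp add: p_def poly_sum poly_monom scalar_prod_def atLeast0LessThan
          mult.commute)
    then show ?thesis using v(3) that by simp
  qed
  ultimately have "p = 0"
    using assms \<open>n > 0\<close> by (intro poly_eqI_degree[of "z ` {..<n}"]) (auto simp: card_image)
  then have "v $ e = 0" if "e < n" for e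
    using coeff_p[of e] that by simp
  then show False using v(1,2) by auto
qed

text \<open>The matrix on the left is the Vandermonde matrix times the identity matrix with its last column
  replaced by the coefficients of the interpolant of \<open>g\<close>. The latter factor is upper triangular, so
  its determinant is the top coefficient.\<close>

lemma det_vandermonde_last_column:
  fixes z :: "nat \<Rightarrow> 'a::field"
  assumes "inj_on z {..m}"
  shows "det (mat (m + 1) (m + 1) (\<lambda>(r, c). if c = m then g r else z r ^ c)) =
    det (mat (m + 1) (m + 1) (\<lambda>(r, c). z r ^ c)) * ddiff z {..m} g"
proof -
  let ?V = "mat (m + 1) (m + 1) (\<lambda>(r, c). z r ^ c)"
  let ?G = "mat (m + 1) (m + 1) (\<lambda>(r, c). if c = m then g r else z r ^ c)"
  define L where "L = lagrange z {..m} g"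
  define U where "U = mat (m + 1) (m + 1) (\<lambda>(e, c). if c = m then coeff L e else of_bool (e = c))"
  have deg: "degree L \<le> m"
    using degree_lagrange_less[of "{..m}" z g] by (simp add: L_def)
  have "?V * U = ?G"
  proof (rule eq_matI)
    fix r c assume "r < dim_row ?G" "c < dim_col ?G"
    then have rc: "r \<le> m" "c \<le> m" by auto
    have "(?V * U) $$ (r, c) = (\<Sum>e\<le>m. z r ^ e * U $$ (e, c))"
      using rc by (simp add: U_def scalar_prod_def atLeast0LessThan lessThan_Suc_atMost
        del: lessThan_Suc atMost_Suc sum.lessThan_Suc sum.atMost_Suc)
    also have "\<dots> = ?G $$ (r, c)"
    proof (cases "c = m")
      case True
      have "(\<Sum>e\<le>m. z r ^ e * U $$ (e, c)) = (\<Sum>e\<le>m. coeff L e * z r ^ e)"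
        using True by (intro sum.cong) (auto simp: U_def)
      also have "\<dots> = poly L (z r)"
        unfolding poly_altdef using deg
        by (intro sum.mono_neutral_right) (auto simp: coeff_eq_0)
      also have "\<dots> = g r"
        unfolding L_def using rc assms by (intro poly_lagrange_node) auto
      finally show ?thesis using rc True by simp
    next
      case False
      then have "(\<Sum>e\<le>m. z r ^ e * U $$ (e, c)) = (\<Sum>e\<le>m. if e = c then z r ^ e else 0)"
        using rc by (intro sum.cong) (auto simp: U_def)
      then show ?thesis using rc False by simp
    qed
    finally show "(?V * U) $$ (r, c) = ?G $$ (r, c)" .
  qed (auto simp: U_def)
  moreover have "det (?V * U) = det ?V * det U"
    by (rule det_mult) (auto simp: U_def)
  moreover have "det U = ddiff z {..m} g"
  proof -
    have "det U = prod_list (diag_mat U)"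
      by (rule det_upper_triangular[of _ "m + 1"]) (auto simp: U_def)
    also have "\<dots> = (\<Prod>e<m + 1. U $$ (e, e))"
      by (simp add: prod_list_diag_prod U_def atLeast0LessThan)
    also have "\<dots> = coeff L m"
      by (simp add: U_def)
    also have "\<dots> = ddiff z {..m} g"
      using coeff_lagrange[of "{..m}" z g] by (simp add: L_def)
    finally show ?thesis .
  qed
  ultimately show ?thesis by simp
qed

lemma det_scale_rows:
  "det (mat n n (\<lambda>(r, c). a r * A (r, c))) = (\<Prod>r<n. a r) * det (mat n n A)"
proof -
  have "mat n n (\<lambda>(r, c). a r * A (r, c)) = mat\<^sub>r n n (\<lambda>r. a r \<cdot>\<^sub>v vec n (\<lambda>c. A (r, c)))"
    "mat n n A = mat\<^sub>r n n (\<lambda>r. vec n (\<lambda>c. A (r, c)))"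
    by (auto intro!: eq_matI)
  then show ?thesis
    using det_rows_mul[of "\<lambda>r. vec n (\<lambda>c. A (r, c))" n a] by (simp add: atLeast0LessThan)
qed

text \<open>Coefficients of the \<open>c\<close>-th function of a trigonometric system of \<open>N\<close> functions, multiplied by
  \<open>z\<^sup>(\<^sup>N\<^sup>-\<^sup>1\<^sup>)\<^sup>/\<^sup>2\<close>, as a polynomial in \<open>z\<close>; \<open>u\<close> and \<open>l\<close> are the two exponents that occur. The system with
  integer frequencies belongs to odd \<open>N\<close>, the one with half-integer frequencies to even \<open>N\<close>. In both
  cases the cosines are the columns with \<open>N + c\<close> even, which allows a uniform treatment; only the
  constant function, with \<open>u = l\<close>, is a case of its own.\<close>

definition trig_coeff :: "nat \<Rightarrow> nat \<Rightarrow> nat \<Rightarrow> complex" where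
  "trig_coeff N e c =
     (let u = (N + c) div 2; l = N - 1 - u
      in if odd N \<and> c = 0 then of_bool (e = u)
         else if even (N + c) then (of_bool (e = u) + of_bool (e = l)) / 2
         else (of_bool (e = u) - of_bool (e = l)) / (2 * \<i>))"

definition trig_coeff_mat :: "nat \<Rightarrow> complex mat" where
  "trig_coeff_mat N = mat N N (\<lambda>(e, c). trig_coeff N e c)"

lemma trig_coeff_mat_carrier [simp]: "trig_coeff_mat N \<in> carrier_mat N N"
  by (simp add: trig_coeff_mat_def)

lemma trig_coeff_shift:
  assumes "c < N"
  shows "trig_coeff (N + 2) (Suc e) c = trig_coeff N e c"
proof -
  have 1: "(N + 2 + c) div 2 = Suc ((N + c) div 2)" by simp
  have 2: "N + 2 - 1 - Suc ((N + c) div 2) = Suc (N - 1 - (N + c) div 2)"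
    using assms by linarith
  show ?thesis unfolding trig_coeff_def Let_def 1 2 by simp
qed

lemma trig_coeff_border:
  assumes "c < N"
  shows "trig_coeff (N + 2) 0 c = 0" "trig_coeff (N + 2) (N + 1) c = 0"
proof -
  have "(N + 2 + c) div 2 \<noteq> 0" "N + 2 - 1 - (N + 2 + c) div 2 \<noteq> 0"
     "(N + 2 + c) div 2 \<noteq> N + 1" "N + 2 - 1 - (N + 2 + c) div 2 \<noteq> N + 1"
    using assms by linarith+
  then show "trig_coeff (N + 2) 0 c = 0" "trig_coeff (N + 2) (N + 1) c = 0"
    unfolding trig_coeff_def Let_def by (auto simp del: of_bool_eq_iff)
qed

lemma trig_coeff_top:
  "trig_coeff (N + 2) 0 N = 1 / 2" "trig_coeff (N + 2) (N + 1) N = 1 / 2"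
  "trig_coeff (N + 2) 0 (N + 1) = - 1 / (2 * \<i>)" "trig_coeff (N + 2) (N + 1) (N + 1) = 1 / (2 * \<i>)"
proof -
  have "(N + 2 + N) div 2 = N + 1" "(N + 2 + (N + 1)) div 2 = N + 1" by simp_all
  moreover have "N + 2 - 1 - (N + 1) = 0" by simp
  ultimately show
    "trig_coeff (N + 2) 0 N = 1 / 2" "trig_coeff (N + 2) (N + 1) N = 1 / 2"
    "trig_coeff (N + 2) 0 (N + 1) = - 1 / (2 * \<i>)" "trig_coeff (N + 2) (N + 1) (N + 1) = 1 / (2 * \<i>)"
    unfolding trig_coeff_def Let_def by auto
qed

lemma det_last_row:
  assumes "A \<in> carrier_mat (Suc n) (Suc n)" "\<And>c. c < n \<Longrightarrow> A $$ (n, c) = 0"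
  shows "det A = A $$ (n, n) * det (mat n n (\<lambda>(r, c). A $$ (r, c)))"
proof -
  have "det A = (\<Sum>c<Suc n. A $$ (n, c) * cofactor A n c)"
    using laplace_expansion_row[OF assms(1), of n] by simp
  also have "\<dots> = A $$ (n, n) * cofactor A n n"
    using assms(2) by simp
  also have "mat_delete A n n = mat n n (\<lambda>(r, c). A $$ (r, c))"
    using assms(1) by (auto simp: mat_delete_def)
  then have "cofactor A n n = det (mat n n (\<lambda>(r, c). A $$ (r, c)))"
    by (simp add: cofactor_def)
  finally show ?thesis .
qed

text \<open>Passing from \<open>N\<close> to \<open>N + 2\<close> adds one exponent at each end and one cosine-sine pair of top
  frequency, which alone involves the two new exponents. Expanding along the first row therefore
  leaves two bordered copies of the smaller matrix.\<close>

lemma det_trig_coeff_mat_step: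
  "det (trig_coeff_mat (N + 2)) = (- 1) ^ N / (2 * \<i>) * det (trig_coeff_mat N)"
proof -
  define B where "B = trig_coeff_mat (N + 2)"
  have B: "B \<in> carrier_mat (Suc (Suc N)) (Suc (Suc N))"
    using trig_coeff_mat_carrier[of "N + 2"] by (simp add: B_def)
  have entry: "B $$ (e, c) = trig_coeff (N + 2) e c" if "e < N + 2" "c < N + 2" for e c
    using that by (simp add: B_def trig_coeff_mat_def)
  have minor: "det (mat_delete B 0 c) = trig_coeff (N + 2) (N + 1) d * det (trig_coeff_mat N)"
    if "c = N \<and> d = N + 1 \<or> c = N + 1 \<and> d = N" for c d
  proof -
    have car: "mat_delete B 0 c \<in> carrier_mat (Suc N) (Suc N)"
      using mat_delete_carrier[OF B] by simp
    have md: "mat_delete B 0 c $$ (e, k) = trig_coeff (N + 2) (Suc e) (if k < N then k else d)"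
      if "e \<le> N" "k \<le> N" for e k
      using that \<open>c = N \<and> d = N + 1 \<or> c = N + 1 \<and> d = N\<close> B
      by (auto simp: mat_delete_def B_def trig_coeff_mat_def)
    have "det (mat_delete B 0 c) = mat_delete B 0 c $$ (N, N)
       * det (mat N N (\<lambda>(r, k). mat_delete B 0 c $$ (r, k)))"
      by (rule det_last_row[OF car]) (use trig_coeff_border in \<open>simp add: md\<close>)
    also have "mat N N (\<lambda>(r, k). mat_delete B 0 c $$ (r, k)) = trig_coeff_mat N"
      by (rule eq_matI) (auto simp: md trig_coeff_mat_def trig_coeff_shift[simplified])
    also have "mat_delete B 0 c $$ (N, N) = trig_coeff (N + 2) (N + 1) d"
      by (simp add: md)
    finally show ?thesis .
  qed
  have "det B = (\<Sum>c<Suc (Suc N). B $$ (0, c) * cofactor B 0 c)"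
    using laplace_expansion_row[OF B, of 0] by simp
  also have "\<dots> = B $$ (0, N) * cofactor B 0 N + B $$ (0, N + 1) * cofactor B 0 (N + 1)"
    using trig_coeff_border[of _ N] by (simp add: entry)
  also have "\<dots> = (- 1) ^ N / (2 * \<i>) * det (trig_coeff_mat N)"
    unfolding cofactor_def using minor[of N "N + 1"] minor[of "N + 1" N]
    by (simp only: entry trig_coeff_top) (simp add: entry trig_coeff_top[simplified] field_simps)
  finally show ?thesis unfolding B_def .
qed

lemma det_trig_coeff_mat:
  "det (trig_coeff_mat (2 * n)) = (1 / (2 * \<i>)) ^ n"
  "det (trig_coeff_mat (2 * n + 1)) = (- 1 / (2 * \<i>)) ^ n"
proof (induction n)
  case 0
  show "det (trig_coeff_mat (2 * 0)) = (1 / (2 * \<i>)) ^ 0"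
    using trig_coeff_mat_carrier[of 0] by simp
  show "det (trig_coeff_mat (2 * 0 + 1)) = (- 1 / (2 * \<i>)) ^ 0"
    using trig_coeff_mat_carrier[of 1] by (simp add: det_single trig_coeff_mat_def trig_coeff_def)
next
  case (Suc n)
  have "2 * Suc n = 2 * n + 2" "2 * Suc n + 1 = (2 * n + 1) + 2" by simp_all
  then show "det (trig_coeff_mat (2 * Suc n)) = (1 / (2 * \<i>)) ^ Suc n"
    "det (trig_coeff_mat (2 * Suc n + 1)) = (- 1 / (2 * \<i>)) ^ Suc n"
    using det_trig_coeff_mat_step[of "2 * n"] det_trig_coeff_mat_step[of "2 * n + 1"] Suc.IH
    by (simp_all only:) simp_all
qed

lemma det_trig_coeff_mat_nonzero: "det (trig_coeff_mat N) \<noteq> 0"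
proof -
  consider n where "N = 2 * n" | n where "N = 2 * n + 1" by (metis oddE evenE)
  then show ?thesis by cases (simp_all only: det_trig_coeff_mat, simp_all)
qed

text \<open>The powers of two in the definition of the divided difference compensate the ratio of the
  constant determinants belonging to the two systems.\<close>

lemma trig_normalization:
  "(if odd m then 2 ^ (m - 1) else 2 ^ m) * det (trig_coeff_mat m) / det (trig_coeff_mat (m + 1))
     = (2 * \<i>) ^ m"
proof -
  consider n where "m = 2 * n" | n where "m = 2 * n + 1" by (metis oddE evenE)
  then show ?thesis
  proof cases
    case 1
    have d: "det (trig_coeff_mat m) = (1 / (2 * \<i>)) ^ n"
      "det (trig_coeff_mat (m + 1)) = (- 1 / (2 * \<i>)) ^ n"
      by (simp_all only: det_trig_coeff_mat 1)
    have "(2 ^ m :: complex) * (1 / (2 * \<i>)) ^ n / (- 1 / (2 * \<i>)) ^ n =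
       4 ^ n * ((1 / (2 * \<i>)) / (- 1 / (2 * \<i>))) ^ n"
      unfolding power_divide[of "1 / (2 * \<i>)" "- 1 / (2 * \<i>)"] 1
      by (simp only: times_divide_eq_right) (simp add: power_mult)
    also have "(1 / (2 * \<i>)) / (- 1 / (2 * \<i>)) = -1"
      by simp
    also have "(4::complex) ^ n * (- 1) ^ n = (2 * \<i>) ^ m"
      by (simp add: 1 power_mult power_mult_distrib flip: power_mult_distrib)
    finally show ?thesis
      unfolding d using 1 by simp
  next
    case 2
    then have e: "m + 1 = 2 * Suc n" by simp
    have d: "det (trig_coeff_mat m) = (- 1 / (2 * \<i>)) ^ n"
      "det (trig_coeff_mat (m + 1)) = (1 / (2 * \<i>)) ^ n / (2 * \<i>)"
      unfolding e by (simp_all only: det_trig_coeff_mat 2) simp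
    have "(2 ^ (m - 1) :: complex) * (- 1 / (2 * \<i>)) ^ n / ((1 / (2 * \<i>)) ^ n / (2 * \<i>)) =
       4 ^ n * ((- 1 / (2 * \<i>)) / (1 / (2 * \<i>))) ^ n * (2 * \<i>)"
      unfolding power_divide[of "- 1 / (2 * \<i>)" "1 / (2 * \<i>)"] 2
      by (simp only: divide_divide_eq_right times_divide_eq_left times_divide_eq_right)
        (simp add: power_mult)
    also have "(- 1 / (2 * \<i>)) / (1 / (2 * \<i>)) = -1"
      by simp
    also have "(4::complex) ^ n * (- 1) ^ n * (2 * \<i>) = (2 * \<i>) ^ m"
      by (simp add: 2 power_mult flip: power_mult_distrib)
    finally show ?thesis
      unfolding d using 2 by simp
  qed
qed

section \<open>Trigonometric divided differences in exponential form\<close>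

lemma hexp_add: "hexp h (a + b) = hexp h a * hexp h b"
  by (simp add: hexp_def ring_distribs exp_add add_divide_distrib)

lemma hexp_nonzero [simp]: "hexp h a \<noteq> 0"
  by (simp add: hexp_def)

lemma hexp_minus: "hexp h (- a) = inverse (hexp h a)"
  by (simp add: hexp_def exp_minus)

lemma hexp_diff: "hexp h (a - b) = hexp h a / hexp h b"
  using hexp_add[of h a "- b"] by (simp add: hexp_minus divide_inverse)

lemma hexp_of_nat: "hexp h (real n * a) = hexp h a ^ n"
  by (simp add: hexp_def exp_of_nat_mult[symmetric] mult_ac)

lemma hexp_half: "hexp h (a / 2) ^ 2 = hexp h a"
  using hexp_of_nat[of h 2 "a / 2"] by simp

text \<open>The bound on the spread of the nodes is the period of \<open>hexp h\<close>.\<close>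

lemma hexp_eq_imp_eq:
  assumes "h \<noteq> 0" "h > -1" "\<bar>a - b\<bar> < 2 * pi * h / ln (1 + h)" "hexp h a = hexp h b"
  shows "a = b"
proof -
  define \<kappa> where "\<kappa> = ln (1 + h) / h"
  have "\<kappa> > 0"
    using assms(1,2) unfolding \<kappa>_def
    by (cases "h > 0") (auto intro!: divide_pos_pos divide_neg_neg)
  have spread: "\<bar>a - b\<bar> * \<kappa> < 2 * pi"
  proof -
    have "2 * pi * h / ln (1 + h) = 2 * pi / \<kappa>" by (simp add: \<kappa>_def)
    then show ?thesis using assms(3) \<open>\<kappa> > 0\<close> by (simp add: pos_less_divide_eq)
  qed
  obtain n :: int where "\<i> * of_real a * of_real \<kappa> =
      \<i> * of_real b * of_real \<kappa> + (of_int (2 * n) * pi) * \<i>"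
    using assms(4) unfolding hexp_def \<kappa>_def[symmetric] exp_eq by blast
  then have "Im (\<i> * of_real a * of_real \<kappa>) = 
      Im (\<i> * of_real b * of_real \<kappa> + (of_int (2 * n) * pi) * \<i>)" by simp
  then have n: "(a - b) * \<kappa> = 2 * pi * real_of_int n" by (simp add: algebra_simps)
  then have "\<bar>a - b\<bar> * \<kappa> = 2 * pi * \<bar>real_of_int n\<bar>"
    using \<open>\<kappa> > 0\<close> by (metis abs_mult abs_of_pos pi_gt_zero zero_less_mult_iff zero_less_numeral)
  then have "\<bar>real_of_int n\<bar> < 1" using spread by simp
  then have "n = 0" by linarith
  then show ?thesis using n \<open>\<kappa> > 0\<close> by simp
qed

lemma hsin_half_diff:
  "hsin h ((a - b) / 2) = (hexp h a - hexp h b) / (2 * \<i> * (hexp h (a / 2) * hexp h (b / 2)))"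
proof -
  have "hexp h ((a - b) / 2) = hexp h (a / 2) / hexp h (b / 2)"
    "hexp h (- ((a - b) / 2)) = hexp h (b / 2) / hexp h (a / 2)"
    using hexp_diff[of h "a / 2" "b / 2"] hexp_diff[of h "b / 2" "a / 2"]
    by (simp_all add: diff_divide_distrib)
  then show ?thesis
    unfolding hsin_def hexp_half[of h a, symmetric] hexp_half[of h b, symmetric]
    by (simp add: field_simps power2_eq_square)
qed

lemma inj_on_hexp:
  fixes t :: "nat \<Rightarrow> real"
  assumes "h \<noteq> 0" "h > -1" "strict_mono_on {..m} t" "t m - t 0 < 2 * pi * h / ln (1 + h)"
  shows "inj_on (\<lambda>i. hexp h (t i)) {..m}"
proof (rule inj_onI)
  fix i j assume ij: "i \<in> {..m}" "j \<in> {..m}" "hexp h (t i) = hexp h (t j)"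
  have mono: "t i \<le> t j" if "i \<le> j" "j \<le> m" for i j
    using strict_mono_on_leD[OF assms(3), of i j] that by auto
  have "\<bar>t i - t j\<bar> \<le> t m - t 0"
    using mono[of 0 i] mono[of 0 j] mono[of i m] mono[of j m] ij by auto
  then have "t i = t j"
    using hexp_eq_imp_eq[OF assms(1,2) _ ij(3)] assms(4) by linarith
  then show "i = j" using strict_mono_on_imp_inj_on[OF assms(3)] ij by (auto dest: inj_onD)
qed

definition trig_sys :: "real \<Rightarrow> nat \<Rightarrow> nat \<Rightarrow> real \<Rightarrow> complex" where
  "trig_sys h N = (if odd N then int_sys h else half_sys h)"

lemma trig_sys_expand:
  assumes "c < N"
  shows "hexp h (x / 2) ^ (N - 1) * trig_sys h N c x = (\<Sum>e<N. hexp h x ^ e * trig_coeff N e c)"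
proof -
  define w where "w = hexp h (x / 2)"
  define u where "u = (N + c) div 2"
  define l where "l = N - 1 - u"
  have ul: "u < N" "l < N" "u + l = N - 1" using assms by (auto simp: u_def l_def)
  have sel: "(\<Sum>e<N. hexp h x ^ e * of_bool (e = k)) = w ^ (2 * k)" if "k < N" for k
  proof -
    have "(\<Sum>e<N. hexp h x ^ e * of_bool (e = k)) = (\<Sum>e<N. if e = k then hexp h x ^ e else 0)"
      by (intro sum.cong) auto
    then show ?thesis using that hexp_half[of h x] by (simp add: w_def power_mult)
  qed
  have w: "w \<noteq> 0" by (simp add: w_def)
  define \<theta> where "\<theta> = (real u - real l) * (x / 2)"
  have "\<theta> = real u * (x / 2) - real l * (x / 2)" "- \<theta> = real l * (x / 2) - real u * (x / 2)"
    by (simp_all add: \<theta>_def algebra_simps diff_divide_distrib)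
  then have "hexp h \<theta> = w ^ u / w ^ l" "hexp h (- \<theta>) = w ^ l / w ^ u"
    by (simp_all only: hexp_diff hexp_of_nat w_def)
  moreover have "w ^ (N - 1) = w ^ u * w ^ l"
    unfolding ul(3)[symmetric] by (rule power_add)
  ultimately have E: "w ^ (N - 1) * hexp h \<theta> = w ^ (2 * u)" "w ^ (N - 1) * hexp h (- \<theta>) = w ^ (2 * l)"
    using w by (simp_all add: mult_2 power_add)
  show ?thesis
  proof (cases "odd N \<and> c = 0")
    case True
    then have "2 * u = N - 1" by (auto simp: u_def elim!: oddE)
    moreover have "(\<Sum>e<N. hexp h x ^ e * trig_coeff N e c) = (\<Sum>e<N. hexp h x ^ e * of_bool (e = u))"
      using True by (intro sum.cong) (simp_all add: trig_coeff_def u_def)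
    moreover have "trig_sys h N c x = 1"
      using True by (simp add: trig_sys_def int_sys_def)
    ultimately show ?thesis
      unfolding w_def[symmetric] by (simp only: sel[OF ul(1)] mult_1_right)
  next
    case False
    show ?thesis
    proof (cases "even (N + c)")
      case True
      have "real u - real l = real c + 1"
      proof -
        have "2 * u = N + c" using True by (simp add: u_def)
        then show ?thesis using ul(3) assms by linarith
      qed
      then have \<theta>: "\<theta> = (real c + 1) / 2 * x" by (simp add: \<theta>_def)
      have "trig_sys h N c x = hcos h \<theta>"
      proof (cases "odd N")
        case True
        then have "odd c" using \<open>even (N + c)\<close> by simp
        then have "real ((c + 1) div 2) * x = \<theta>" by (auto simp: \<theta> elim!: oddE)
        moreover have "trig_sys h N c x = hcos h (real ((c + 1) div 2) * x)"
          using True \<open>odd c\<close> by (auto simp: trig_sys_def int_sys_def)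
        ultimately show ?thesis by simp
      next
        case False
        then have "even c" using \<open>even (N + c)\<close> by simp
        then have "(real (c div 2) + 1 / 2) * x = \<theta>" by (auto simp: \<theta> elim!: evenE)
        moreover have "trig_sys h N c x = hcos h ((real (c div 2) + 1 / 2) * x)"
          using False \<open>even c\<close> by (simp add: trig_sys_def half_sys_def)
        ultimately show ?thesis by simp
      qed
      moreover have "(\<Sum>e<N. hexp h x ^ e * trig_coeff N e c) = (w ^ (2 * u) + w ^ (2 * l)) / 2"
      proof -
        have tc: "trig_coeff N e c = (of_bool (e = u) + of_bool (e = l)) / 2" for e
          unfolding trig_coeff_def Let_def u_def[symmetric] l_def[symmetric]
            if_not_P[OF False] if_P[OF True] ..
        show ?thesis
          unfolding tc sel[OF ul(1), symmetric] sel[OF ul(2), symmetric] sum_divide_distrib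
            sum.distrib[symmetric]
          by (simp only: distrib_left times_divide_eq_right)
      qed
      ultimately show ?thesis
        unfolding w_def[symmetric] by (simp only: E hcos_def distrib_left times_divide_eq_right)
    next
      case odd: False
      have "real u - real l = real c"
      proof -
        have "2 * u = N + c - 1" using odd unfolding u_def by presburger
        then show ?thesis using ul(3) assms by linarith
      qed
      then have \<theta>: "\<theta> = real c / 2 * x" by (simp add: \<theta>_def)
      have "trig_sys h N c x = hsin h \<theta>"
      proof (cases "odd N")
        case True
        then have "even c" using odd by simp
        then have "real (c div 2) * x = \<theta>" by (auto simp: \<theta> elim!: evenE)
        moreover have "trig_sys h N c x = hsin h (real (c div 2) * x)"
          using True \<open>even c\<close> False by (auto simp: trig_sys_def int_sys_def)
        ultimately show ?thesis by simp
      next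
        case False
        then have "odd c" using odd by simp
        then have "(real (c div 2) + 1 / 2) * x = \<theta>" by (auto simp: \<theta> field_simps elim!: oddE)
        moreover have "trig_sys h N c x = hsin h ((real (c div 2) + 1 / 2) * x)"
          using False \<open>odd c\<close> by (simp add: trig_sys_def half_sys_def)
        ultimately show ?thesis by simp
      qed
      moreover have "(\<Sum>e<N. hexp h x ^ e * trig_coeff N e c) = (w ^ (2 * u) - w ^ (2 * l)) / (2 * \<i>)"
      proof -
        have tc: "trig_coeff N e c = (of_bool (e = u) - of_bool (e = l)) / (2 * \<i>)" for e
          unfolding trig_coeff_def Let_def u_def[symmetric] l_def[symmetric]
            if_not_P[OF False] if_not_P[OF odd] ..
        show ?thesis
          unfolding tc sel[OF ul(1), symmetric] sel[OF ul(2), symmetric] sum_divide_distrib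
            sum_subtractf[symmetric]
          by (simp only: right_diff_distrib times_divide_eq_right)
      qed
      ultimately show ?thesis
        unfolding w_def[symmetric] by (simp only: E hsin_def right_diff_distrib times_divide_eq_right)
    qed
  qed
qed

text \<open>Scaling row \<open>r\<close> by \<open>z\<^sub>r\<^sup>m\<^sup>/\<^sup>2\<close> makes all entries polynomials in \<open>z\<^sub>r\<close>, and the matrix factors into the
  Vandermonde matrix and the constant coefficient matrix.\<close>

lemma sysdet_trig_sys:
  "(\<Prod>r\<le>m. hexp h (t r / 2)) ^ m * sysdet m (trig_sys h (m + 1)) t =
     det (mat (m + 1) (m + 1) (\<lambda>(r, c). hexp h (t r) ^ c)) * det (trig_coeff_mat (m + 1))"
proof -
  let ?V = "mat (m + 1) (m + 1) (\<lambda>(r, c). hexp h (t r) ^ c)"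
  let ?A = "mat (m + 1) (m + 1)
    (\<lambda>(r, c). hexp h (t r / 2) ^ m * (\<lambda>(r, c). trig_sys h (m + 1) c (t r)) (r, c))"
  have "?V * trig_coeff_mat (m + 1) = ?A"
  proof (rule eq_matI)
    fix r c assume "r < dim_row ?A" "c < dim_col ?A"
    then have rc: "r < m + 1" "c < m + 1" by auto
    have "(?V * trig_coeff_mat (m + 1)) $$ (r, c) =
        (\<Sum>e<m + 1. hexp h (t r) ^ e * trig_coeff (m + 1) e c)"
      using rc by (simp add: trig_coeff_mat_def scalar_prod_def atLeast0LessThan
          del: sum.lessThan_Suc)
    also have "\<dots> = ?A $$ (r, c)"
      using rc trig_sys_expand[of c "m + 1" h "t r"] by simp
    finally show "(?V * trig_coeff_mat (m + 1)) $$ (r, c) = ?A $$ (r, c)" .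
  qed (auto simp: trig_coeff_mat_def)
  then have "det ?A = det ?V * det (trig_coeff_mat (m + 1))"
    using det_mult[of ?V "m + 1" "trig_coeff_mat (m + 1)"] by simp
  moreover have "det ?A = (\<Prod>r\<le>m. hexp h (t r / 2)) ^ m * sysdet m (trig_sys h (m + 1)) t"
    unfolding det_scale_rows[of _ "\<lambda>r. hexp h (t r / 2) ^ m" "\<lambda>(r, c). trig_sys h (m + 1) c (t r)"]
    by (simp only: prod_power_distrib sysdet_def Suc_eq_plus1[symmetric] lessThan_Suc_atMost)
  ultimately show ?thesis by simp
qed

text \<open>The numerator: here the first \<open>m\<close> columns need only the scaling by \<open>z\<^sub>r\<^sup>(\<^sup>m\<^sup>-\<^sup>1\<^sup>)\<^sup>/\<^sup>2\<close>, and the same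
  scaling acts on the column of \<open>f\<close>.\<close>

lemma sysdet_trig_sys_last:
  assumes "inj_on (\<lambda>i. hexp h (t i)) {..m}"
  shows "(\<Prod>r\<le>m. hexp h (t r / 2)) ^ (m - 1) * sysdet m ((trig_sys h m)(m := f)) t =
     det (mat (m + 1) (m + 1) (\<lambda>(r, c). hexp h (t r) ^ c)) * det (trig_coeff_mat m) *
     ddiff (\<lambda>i. hexp h (t i)) {..m} (\<lambda>i. f (t i) * hexp h (t i / 2) ^ (m - 1))"
proof -
  define g where "g i = f (t i) * hexp h (t i / 2) ^ (m - 1)" for i
  let ?G = "mat (m + 1) (m + 1) (\<lambda>(r, c). if c = m then g r else hexp h (t r) ^ c)"
  \<comment> \<open>The coefficient matrix of order \<open>m\<close>, bordered by a unit vector that reproduces the column of \<open>f\<close>.\<close>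
  define B where "B = mat (m + 1) (m + 1) (\<lambda>(e, c). if c < m \<and> e < m then trig_coeff m e c
     else of_bool (e = c))"
  have B: "B \<in> carrier_mat (Suc m) (Suc m)" by (simp add: B_def)
  let ?A = "mat (m + 1) (m + 1)
    (\<lambda>(r, c). hexp h (t r / 2) ^ (m - 1) * (\<lambda>(r, c). ((trig_sys h m)(m := f)) c (t r)) (r, c))"
  have "?G * B = ?A"
  proof (rule eq_matI)
    fix r c assume "r < dim_row ?A" "c < dim_col ?A"
    then have rc: "r < m + 1" "c < m + 1" by auto
    have "(?G * B) $$ (r, c) = (\<Sum>e<m + 1. (if e = m then g r else hexp h (t r) ^ e) * B $$ (e, c))"
      using rc by (simp add: B_def scalar_prod_def atLeast0LessThan del: sum.lessThan_Suc)
    also have "\<dots> = (\<Sum>e<m. hexp h (t r) ^ e * B $$ (e, c)) + g r * B $$ (m, c)"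
      by simp
    also have "\<dots> = ?A $$ (r, c)"
    proof (cases "c = m")
      case True
      then show ?thesis using rc by (simp add: B_def g_def)
    next
      case False
      then show ?thesis using rc trig_sys_expand[of c m h "t r"] by (simp add: B_def)
    qed
    finally show "(?G * B) $$ (r, c) = ?A $$ (r, c)" .
  qed (auto simp: B_def)
  moreover have "det (?G * B) = det ?G * det B"
    using B by (intro det_mult) auto
  moreover have "det B = det (trig_coeff_mat m)"
  proof -
    have "mat m m (\<lambda>(r, c). B $$ (r, c)) = trig_coeff_mat m"
      by (rule eq_matI) (auto simp: B_def trig_coeff_mat_def)
    moreover have "det B = B $$ (m, m) * det (mat m m (\<lambda>(r, c). B $$ (r, c)))"
      by (rule det_last_row[OF B]) (auto simp: B_def)
    ultimately show ?thesis by (simp add: B_def)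
  qed
  ultimately have "det ?A = det (mat (m + 1) (m + 1) (\<lambda>(r, c). hexp h (t r) ^ c)) *
      ddiff (\<lambda>i. hexp h (t i)) {..m} g * det (trig_coeff_mat m)"
    using det_vandermonde_last_column[OF assms, of g] by simp
  moreover have "det ?A = (\<Prod>r\<le>m. hexp h (t r / 2)) ^ (m - 1) * sysdet m ((trig_sys h m)(m := f)) t"
    unfolding det_scale_rows[of _ "\<lambda>r. hexp h (t r / 2) ^ (m - 1)"
        "\<lambda>(r, c). ((trig_sys h m)(m := f)) c (t r)"]
    by (simp only: prod_power_distrib sysdet_def Suc_eq_plus1[symmetric] lessThan_Suc_atMost)
  ultimately show ?thesis unfolding g_def by (simp add: mult_ac)
qed

text \<open>In the quotient the Vandermonde determinant cancels, and the different scalings of numerator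
  and denominator leave one factor \<open>z\<^sub>r\<^sup>1\<^sup>/\<^sup>2\<close> for each node.\<close>

lemma divdiff_distinct_eq_ddiff:
  assumes "inj_on (\<lambda>i. hexp h (t i)) {..m}" "m \<ge> 1"
  shows "divdiff_distinct m t h f = (2 * \<i>) ^ m * (\<Prod>i\<le>m. hexp h (t i / 2)) *
     ddiff (\<lambda>i. hexp h (t i)) {..m} (\<lambda>i. f (t i) * hexp h (t i / 2) ^ (m - 1))"
proof -
  define W where "W = (\<Prod>i\<le>m. hexp h (t i / 2))"
  define V where "V = det (mat (m + 1) (m + 1) (\<lambda>(r, c). hexp h (t r) ^ c))"
  define D where "D = ddiff (\<lambda>i. hexp h (t i)) {..m} (\<lambda>i. f (t i) * hexp h (t i / 2) ^ (m - 1))"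
  define \<beta> where "\<beta> = det (trig_coeff_mat m)"
  define \<beta>' where "\<beta>' = det (trig_coeff_mat (m + 1))"
  define C :: complex where "C = (if odd m then 2 ^ (m - 1) else 2 ^ m)"
  have "V \<noteq> 0"
    unfolding V_def using assms(1)
    by (intro det_vandermonde_nonzero) (simp add: lessThan_Suc_atMost)
  moreover have "W \<noteq> 0" by (simp add: W_def)
  moreover have "\<beta>' \<noteq> 0" unfolding \<beta>'_def by (rule det_trig_coeff_mat_nonzero)
  ultimately have nz: "V \<noteq> 0" "W \<noteq> 0" "\<beta>' \<noteq> 0" .
  have den: "sysdet m (trig_sys h (m + 1)) t = V * \<beta>' / W ^ m"
    using sysdet_trig_sys[of h t m] nz unfolding W_def V_def \<beta>'_def by (simp add: field_simps)
  have num: "sysdet m ((trig_sys h m)(m := f)) t = V * \<beta> * D / W ^ (m - 1)"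
    using sysdet_trig_sys_last[OF assms(1), of f] nz unfolding W_def V_def \<beta>_def D_def
    by (simp add: field_simps)
  have "divdiff_distinct m t h f =
     C * sysdet m ((trig_sys h m)(m := f)) t / sysdet m (trig_sys h (m + 1)) t"
    by (simp add: divdiff_distinct_def trig_sys_def C_def)
  also have "\<dots> = C * \<beta> / \<beta>' * (W * D)"
    unfolding num den using nz assms(2) by (cases m) (simp_all add: field_simps)
  also have "C * \<beta> / \<beta>' = (2 * \<i>) ^ m"
    unfolding C_def \<beta>_def \<beta>'_def by (rule trig_normalization)
  finally show ?thesis by (simp add: W_def D_def)
qed

section \<open>Truncated powers at coalescing nodes\<close>

text \<open>The \<open>h\<close>-power of exponent \<open>p\<close>, multiplied by \<open>z\<^sup>p\<^sup>/\<^sup>2\<close>, as a polynomial in \<open>z = hexp h y\<close>.\<close>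

definition hpower_poly :: "real \<Rightarrow> nat \<Rightarrow> real \<Rightarrow> complex poly" where
  "hpower_poly h p x =
     (\<Prod>l<p. smult (1 / (2 * \<i> * hexp h ((x - real l * h) / 2))) [:- hexp h (x - real l * h), 1:])"

lemma degree_hpower_poly: "degree (hpower_poly h p x) \<le> p"
proof -
  have "degree (hpower_poly h p x) = (\<Sum>l<p. 1)"
    unfolding hpower_poly_def by (subst degree_prod_eq_sum_degree) auto
  then show ?thesis by simp
qed

lemma poly_hpower_poly:
  "poly (hpower_poly h p x) (hexp h y) = hsin_power h p x y * hexp h (y / 2) ^ p"
proof -
  have "poly (hpower_poly h p x) (hexp h y) =
      (\<Prod>l<p. hsin h ((y - (x - real l * h)) / 2) * hexp h (y / 2))"
    unfolding hpower_poly_def poly_prod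
    by (intro prod.cong refl) (simp add: hsin_half_diff divide_simps)
  then show ?thesis by (simp add: hsin_power_def prod.distrib)
qed

text \<open>The filter of the limit in the definition of the divided difference, except that \<open>t\<close> itself is
  not excluded. With it, strictly increasing and repeated nodes are handled by one limit: at
  strictly increasing \<open>t\<close> a limit can only be the value at \<open>t\<close>.\<close>

definition from_below :: "nat \<Rightarrow> (nat \<Rightarrow> real) \<Rightarrow> (nat \<Rightarrow> real) filter" where
  "from_below m t = inf (nhds t) (principal {s. strict_mono_on {..m} s \<and> (\<forall>i\<le>m. s i \<le> t i)})"

lemma tendsto_coordinate_from_below: "((\<lambda>s. s i) \<longlongrightarrow> t i) (from_below m t)"
proof -
  have "((\<lambda>s :: nat \<Rightarrow> real. s i) \<longlongrightarrow> t i) (at t)"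
    using continuous_on_product_coordinates[of i] unfolding continuous_on_def by blast
  then have "((\<lambda>s. s i) \<longlongrightarrow> t i) (nhds t)"
    using tendsto_at_iff_tendsto_nhds[of "\<lambda>s :: nat \<Rightarrow> real. s i" t] by simp
  then show ?thesis
    unfolding from_below_def by (rule tendsto_mono[rotated]) simp
qed

lemma filterlim_from_below:
  fixes T :: "nat \<Rightarrow> nat \<Rightarrow> real"
  assumes "\<And>i. (\<lambda>n. T n i) \<longlonglongrightarrow> t i"
    "\<And>n. strict_mono_on {..m} (T n)" "\<And>n i. i \<le> m \<Longrightarrow> T n i \<le> t i"
  shows "filterlim T (from_below m t) sequentially"
proof -
  have "filterlim T (nhds t) sequentially"
    unfolding limitin_canonical_iff[symmetric] euclidean_product_topology[symmetric] limitin_componentwise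
    using assms(1) by simp
  then show ?thesis
    unfolding from_below_def filterlim_inf filterlim_principal using assms(2,3) by auto
qed

text \<open>Knots with index below \<open>b\<close> are lowered, those further to the left by more, so that a
  non-decreasing sequence becomes strictly increasing.\<close>

definition lowered :: "int \<Rightarrow> (int \<Rightarrow> real) \<Rightarrow> nat \<Rightarrow> int \<Rightarrow> real" where
  "lowered b \<xi> n j = \<xi> j - real_of_int (b - j) / real (Suc n)"

lemma lowered_tendsto: "(\<lambda>n. lowered b \<xi> n j) \<longlonglongrightarrow> \<xi> j"
proof -
  have "(\<lambda>n. real_of_int (b - j) / real (Suc n)) \<longlonglongrightarrow> 0"
    using tendsto_mult[OF tendsto_const[of "real_of_int (b - j)"] LIMSEQ_inverse_real_of_nat]
    by (simp add: divide_inverse)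
  then have "(\<lambda>n. \<xi> j - real_of_int (b - j) / real (Suc n)) \<longlonglongrightarrow> \<xi> j - 0"
    by (intro tendsto_diff tendsto_const)
  then show ?thesis by (simp add: lowered_def)
qed

lemma lowered_le: "j \<le> b \<Longrightarrow> lowered b \<xi> n j \<le> \<xi> j"
  by (simp add: lowered_def)

lemma lowered_from_below:
  assumes "mono_on {j..j + int m} \<xi>" "j + int m \<le> b"
  shows "filterlim (\<lambda>n i. lowered b \<xi> n (j + int i)) (from_below m (\<lambda>i. \<xi> (j + int i))) sequentially"
proof (rule filterlim_from_below)
  fix n
  show "strict_mono_on {..m} (\<lambda>i. lowered b \<xi> n (j + int i))"
  proof (rule strict_mono_onI)
    fix i k assume ik: "i \<in> {..m}" "k \<in> {..m}" "i < k"
    then have "\<xi> (j + int i) \<le> \<xi> (j + int k)" by (intro mono_onD[OF assms(1)]) auto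
    moreover have "real_of_int (b - (j + int k)) / real (Suc n) < real_of_int (b - (j + int i)) / real (Suc n)"
      using ik by (intro divide_strict_right_mono) auto
    ultimately show "lowered b \<xi> n (j + int i) < lowered b \<xi> n (j + int k)"
      unfolding lowered_def by linarith
  qed
next
  fix n i assume "i \<le> m"
  then show "lowered b \<xi> n (j + int i) \<le> \<xi> (j + int i)" using assms(2) by (intro lowered_le) auto
qed (rule lowered_tendsto)

lemma from_below_nontrivial:
  assumes "mono_on {..m} t"
  shows "from_below m t \<noteq> bot"
proof
  assume "from_below m t = bot"
  have "mono_on {0..0 + int m} (\<lambda>j. t (nat j))"
    by (rule mono_onI, rule mono_onD[OF assms]) auto
  from lowered_from_below[OF this order_refl]
  have "filterlim (\<lambda>n i. lowered (0 + int m) (\<lambda>j. t (nat j)) n (0 + int i)) (from_below m t) sequentially"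
    by simp
  then show False using \<open>from_below m t = bot\<close> by (simp add: filterlim_def bot_unique filtermap_bot_iff)
qed

lemma divdiff_eq_limit_from_below:
  assumes "mono_on {..m} t" "((\<lambda>s. divdiff_distinct m s h f) \<longlongrightarrow> l) (from_below m t)"
  shows "divdiff m t h f = l"
proof (cases "strict_mono_on {..m} t")
  case True
  then have "principal {t} \<le> from_below m t"
    by (auto simp: from_below_def le_filter_def eventually_inf_principal eventually_principal
        dest: eventually_nhds_x_imp_x)
  then have "((\<lambda>s. divdiff_distinct m s h f) \<longlongrightarrow> l) (principal {t})"
    using assms(2) by (rule tendsto_mono)
  moreover have "((\<lambda>s. divdiff_distinct m s h f) \<longlongrightarrow> divdiff_distinct m t h f) (principal {t})"
    by (rule tendsto_principal_singleton)
  ultimately have "l = divdiff_distinct m t h f"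
    by (intro tendsto_unique[of "principal {t}"]) (auto simp: principal_eq_bot_iff)
  then show ?thesis using True by (simp add: divdiff_def)
next
  case False
  let ?S = "{s. strict_mono_on {..m} s \<and> (\<forall>i\<le>m. s i \<le> t i)}"
  have "at t within ?S = from_below m t"
    using False by (auto simp: at_within_def from_below_def intro!: arg_cong[where f = "\<lambda>S. inf (nhds t) (principal S)"])
  then show ?thesis
    using False tendsto_Lim[of "from_below m t"] from_below_nontrivial[OF assms(1)] assms(2)
    by (simp add: divdiff_def)
qed

text \<open>Approaching from below, a node of the limit that is at most \<open>x\<close> is only reached from the region
  where the truncated power vanishes, and one above \<open>x\<close> is eventually reached from above \<open>x\<close>. So the
  truncated power may be cut off according to the limit nodes instead of the moving ones.\<close>

lemma eventually_divdiff_distinct_trunc_power: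
  assumes "h \<noteq> 0" "h > -1" "m \<ge> 1" "t m - t 0 < 2 * pi * h / ln (1 + h)"
  shows "\<forall>\<^sub>F s in from_below m t. inj_on (\<lambda>i. hexp h (s i)) {..m} \<and>
     divdiff_distinct m s h (hsin_trunc_power h (m - 1) x) =
       (2 * \<i>) ^ m * (\<Prod>i\<le>m. hexp h (s i / 2)) *
       ddiff (\<lambda>i. hexp h (s i)) {..m}
         (\<lambda>i. if t i > x then poly (hpower_poly h (m - 1) x) (hexp h (s i)) else 0)"
proof -
  have "\<forall>\<^sub>F s in from_below m t. s \<in> {s. strict_mono_on {..m} s \<and> (\<forall>i\<le>m. s i \<le> t i)}"
    unfolding from_below_def eventually_inf_principal by (simp add: always_eventually)
  moreover have "\<forall>\<^sub>F s in from_below m t. s m - s 0 < 2 * pi * h / ln (1 + h)"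
    using assms(4) by (intro order_tendstoD(2)[of _ "t m - t 0"] tendsto_diff tendsto_coordinate_from_below)
  moreover have "\<forall>\<^sub>F s in from_below m t. \<forall>i\<in>{i. i \<le> m \<and> t i > x}. s i > x"
    by (intro eventually_ball_finite ballI order_tendstoD(1)[OF tendsto_coordinate_from_below]) auto
  ultimately show ?thesis
  proof eventually_elim
    case (elim s)
    then have inj: "inj_on (\<lambda>i. hexp h (s i)) {..m}"
      by (intro inj_on_hexp assms(1,2)) auto
    have "hsin_trunc_power h (m - 1) x (s i) * hexp h (s i / 2) ^ (m - 1) =
        (if t i > x then poly (hpower_poly h (m - 1) x) (hexp h (s i)) else 0)" if "i \<le> m" for i
    proof (cases "t i > x")
      case True
      then have "s i > x" using elim that by auto
      then show ?thesis using True by (simp add: hsin_trunc_power_def poly_hpower_poly)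
    next
      case False
      then have "s i \<le> x" using elim that by force
      then show ?thesis using False by (simp add: hsin_trunc_power_def)
    qed
    then have "ddiff (\<lambda>i. hexp h (s i)) {..m}
        (\<lambda>i. hsin_trunc_power h (m - 1) x (s i) * hexp h (s i / 2) ^ (m - 1)) =
      ddiff (\<lambda>i. hexp h (s i)) {..m}
        (\<lambda>i. if t i > x then poly (hpower_poly h (m - 1) x) (hexp h (s i)) else 0)"
      unfolding ddiff_def by (intro sum.cong) auto
    then show ?case
      using inj divdiff_distinct_eq_ddiff[OF inj assms(3)] by simp
  qed
qed

lemma isCont_hexp: "isCont (hexp h) a"
  unfolding hexp_def by (intro continuous_intros)

lemma divdiff_trunc_power_tendsto:
  assumes "h \<noteq> 0" "h > -1" "m \<ge> 1" "mono_on {..m} t" "t m - t 0 < 2 * pi * h / ln (1 + h)"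
  shows "((\<lambda>s. divdiff_distinct m s h (hsin_trunc_power h (m - 1) x)) \<longlongrightarrow>
           divdiff m t h (hsin_trunc_power h (m - 1) x)) (from_below m t)"
proof -
  define U where "U = {i. i \<le> m \<and> t i \<le> x}"
  define V where "V = {i. i \<le> m \<and> t i > x}"
  have UV: "U \<union> V = {..m}" by (auto simp: U_def V_def)
  note ev = eventually_divdiff_distinct_trunc_power[OF assms(1-3,5), of x]
  have lim: "((\<lambda>s. hexp h (c * s i)) \<longlongrightarrow> hexp h (c * t i)) (from_below m t)" for c i
    by (intro isCont_tendsto_compose[OF isCont_hexp] tendsto_intros tendsto_coordinate_from_below)
  have "\<exists>l. ((\<lambda>s. ddiff (\<lambda>i. hexp h (s i)) (U \<union> V)
      (\<lambda>i. if i \<in> V then poly (hpower_poly h (m - 1) x) (hexp h (s i)) else 0)) \<longlongrightarrow> l)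
      (from_below m t)"
  proof (rule ddiff_tendsto_ex[where \<zeta> = "\<lambda>i. hexp h (t i)"])
    show "finite U" "finite V" "U \<inter> V = {}" by (auto simp: U_def V_def)
    show "((\<lambda>s. hexp h (s i)) \<longlongrightarrow> hexp h (t i)) (from_below m t)" for i
      using lim[of 1 i] by simp
    show "\<forall>\<^sub>F s in from_below m t. inj_on (\<lambda>i. hexp h (s i)) (U \<union> V)"
      unfolding UV using ev by eventually_elim auto
    fix u v assume uv: "u \<in> U" "v \<in> V"
    have "t 0 \<le> t u" "t v \<le> t m" using uv by (auto simp: U_def V_def intro!: mono_onD[OF assms(4)])
    then have "\<bar>t u - t v\<bar> < 2 * pi * h / ln (1 + h)"
      using uv assms(5) by (auto simp: U_def V_def)
    then show "hexp h (t u) \<noteq> hexp h (t v)"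
      using hexp_eq_imp_eq[OF assms(1,2), of "t u" "t v"] uv by (auto simp: U_def V_def)
  qed
  then obtain l where l: "((\<lambda>s. ddiff (\<lambda>i. hexp h (s i)) {..m}
      (\<lambda>i. if i \<in> V then poly (hpower_poly h (m - 1) x) (hexp h (s i)) else 0)) \<longlongrightarrow> l)
      (from_below m t)"
    unfolding UV by blast
  have eq: "ddiff (\<lambda>i. hexp h (s i)) {..m}
      (\<lambda>i. if i \<in> V then poly (hpower_poly h (m - 1) x) (hexp h (s i)) else 0) =
     ddiff (\<lambda>i. hexp h (s i)) {..m}
      (\<lambda>i. if t i > x then poly (hpower_poly h (m - 1) x) (hexp h (s i)) else 0)" for s
    unfolding ddiff_def by (intro sum.cong) (auto simp: V_def)
  define L where "L = (2 * \<i>) ^ m * (\<Prod>i\<le>m. hexp h (t i / 2)) * l"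
  have "((\<lambda>s. (2 * \<i>) ^ m * (\<Prod>i\<le>m. hexp h (s i / 2)) * ddiff (\<lambda>i. hexp h (s i)) {..m}
      (\<lambda>i. if i \<in> V then poly (hpower_poly h (m - 1) x) (hexp h (s i)) else 0)) \<longlongrightarrow> L)
      (from_below m t)"
    unfolding L_def using lim[of "1/2"] by (intro tendsto_intros l) simp
  then have "((\<lambda>s. divdiff_distinct m s h (hsin_trunc_power h (m - 1) x)) \<longlongrightarrow> L) (from_below m t)"
    by (rule Lim_transform_eventually) (use ev in eventually_elim, simp add: eq)
  then show ?thesis
    using divdiff_eq_limit_from_below[OF assms(4)] by blast
qed

text \<open>If \<open>x\<close> is not strictly inside the range of the nodes, the truncated power agrees with a
  polynomial of degree less than \<open>m\<close> at all \<open>m + 1\<close> nodes.\<close>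

lemma divdiff_trunc_power_outside:
  assumes "h \<noteq> 0" "h > -1" "m \<ge> 1" "mono_on {..m} t" "t m - t 0 < 2 * pi * h / ln (1 + h)"
    and "x < t 0 \<or> t m \<le> x"
  shows "divdiff m t h (hsin_trunc_power h (m - 1) x) = 0"
proof (rule divdiff_eq_limit_from_below[OF assms(4)])
  have "\<forall>\<^sub>F s in from_below m t. 0 = divdiff_distinct m s h (hsin_trunc_power h (m - 1) x)"
    using eventually_divdiff_distinct_trunc_power[OF assms(1-3,5), of x]
  proof eventually_elim
    case (elim s)
    define Q where "Q = (if x < t 0 then hpower_poly h (m - 1) x else 0)"
    have "degree Q \<le> m - 1" using degree_hpower_poly[of h "m - 1" x] by (simp add: Q_def)
    then have deg: "degree Q < m" using assms(3) by linarith
    have "ddiff (\<lambda>i. hexp h (s i)) {..m}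
         (\<lambda>i. if t i > x then poly (hpower_poly h (m - 1) x) (hexp h (s i)) else 0) = coeff Q (card {..m} - 1)"
    proof (rule ddiff_poly)
      fix i assume i: "i \<in> {..m}"
      then have "t 0 \<le> t i" "t i \<le> t m" by (auto intro!: mono_onD[OF assms(4)])
      then show "(if t i > x then poly (hpower_poly h (m - 1) x) (hexp h (s i)) else 0) =
          poly Q (hexp h (s i))"
        using assms(6) by (auto simp: Q_def)
    qed (use elim deg in auto)
    also have "\<dots> = 0" using deg by (simp add: coeff_eq_0)
    finally show ?case using elim by simp
  qed
  with tendsto_const show "((\<lambda>s. divdiff_distinct m s h (hsin_trunc_power h (m - 1) x)) \<longlongrightarrow> 0) (from_below m t)"
    by (rule Lim_transform_eventually)
qed

text \<open>The interpolant, in the variable \<open>z\<close>, of \<open>f\<close> weighted by \<open>z\<^sup>(\<^sup>m\<^sup>-\<^sup>1\<^sup>)\<^sup>/\<^sup>2\<close>; this weight turns trigonometric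
  functions of order \<open>m\<close> into polynomials of degree less than \<open>m\<close>.\<close>

definition hinterpolant :: "real \<Rightarrow> nat \<Rightarrow> (real \<Rightarrow> complex) \<Rightarrow> (nat \<Rightarrow> real) \<Rightarrow> complex poly" where
  "hinterpolant h m f t =
     lagrange (\<lambda>i. hexp h (t i)) {..<m} (\<lambda>i. f (t i) * hexp h (t i / 2) ^ (m - 1))"

text \<open>\<open>lagrange_exchange\<close> for dropping the first node and adding the last one. The factor
  \<open>hsin h ((t m - t 0) / 2)\<close> supplies \<open>z\<^sub>m - z\<^sub>0\<close>, and all half-integer powers of the nodes cancel.\<close>

lemma divdiff_distinct_telescopes:
  assumes "inj_on (\<lambda>i. hexp h (t i)) {..m}" "m \<ge> 1"
  shows "hsin h ((t m - t 0) / 2) * divdiff_distinct m t h f * (\<Prod>l=1..m-1. hsin h ((y - t l) / 2)) =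
    (poly (hinterpolant h m f (\<lambda>i. t (Suc i))) (hexp h y) - poly (hinterpolant h m f t) (hexp h y))
      / hexp h (y / 2) ^ (m - 1)"
proof -
  define L where "L t = poly (hinterpolant h m f t) (hexp h y)" for t
  define z where "z i = hexp h (t i)" for i
  define g where "g i = f (t i) * hexp h (t i / 2) ^ (m - 1)" for i
  define w where "w i = hexp h (t i / 2)" for i
  define W where "W = hexp h (y / 2)"
  define p where "p = (\<Prod>l=1..m-1. w l)"
  have nz: "w i \<noteq> 0" "W \<noteq> 0" "p \<noteq> 0" for i by (simp_all add: w_def W_def p_def)
  have M: "insert m {1..<m} = {1..m}" "insert 0 {1..<m} = {..<m}" "insert 0 {1..m} = {..m}"
    "{1..m-1} = {1..<m}"
    using assms(2) by auto
  have "L (\<lambda>i. t (Suc i)) = poly (lagrange z {1..m} g) (hexp h y)"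
  proof -
    have S: "{1..m} = Suc ` {..<m}" by (simp add: image_Suc_lessThan)
    have "(\<Prod>k\<in>Suc ` {..<m} - {Suc i}. F k) = (\<Prod>k\<in>{..<m} - {i}. F (Suc k))" for i and F :: "nat \<Rightarrow> complex"
    proof -
      have "Suc ` {..<m} - {Suc i} = Suc ` ({..<m} - {i})" by auto
      then show ?thesis by (simp add: prod.reindex)
    qed
    then show ?thesis
      unfolding L_def hinterpolant_def poly_lagrange S by (simp add: sum.reindex z_def g_def)
  qed
  moreover have "L t = poly (lagrange z {..<m} g) (hexp h y)"
    by (simp add: L_def hinterpolant_def z_def[abs_def] g_def[abs_def])
  moreover have inj: "inj_on z {..m}"
    using assms(1) by (simp add: z_def[abs_def])
  ultimately have step: "L (\<lambda>i. t (Suc i)) - L t =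
      (z m - z 0) * ddiff z {..m} g * (\<Prod>l\<in>{1..<m}. hexp h y - z l)"
    using lagrange_exchange[of "{1..<m}" 0 m z g "hexp h y"] inj assms(2)
    unfolding M by simp
  have "(\<Prod>i\<le>m. w i) = w 0 * (w m * p)"
    unfolding p_def M(3)[symmetric] M(1)[symmetric] M(4) using assms(2) by simp
  then have dd: "divdiff_distinct m t h f = (2 * \<i>) ^ m * (w 0 * (w m * p)) * ddiff z {..m} g"
    using divdiff_distinct_eq_ddiff[OF assms(1,2), of f] by (simp add: z_def[abs_def] g_def[abs_def] w_def)
  have hs: "hsin h ((t m - t 0) / 2) = (z m - z 0) / (2 * \<i> * (w m * w 0))"
    by (simp add: hsin_half_diff z_def w_def)
  have pr: "(\<Prod>l=1..m-1. hsin h ((y - t l) / 2)) =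
      (\<Prod>l\<in>{1..<m}. hexp h y - z l) / ((2 * \<i>) ^ (m - 1) * W ^ (m - 1) * p)"
    unfolding hsin_half_diff prod_dividef p_def M(4)
    by (simp add: z_def w_def W_def prod.distrib power_mult_distrib)
  have pw: "(2 * \<i>) ^ m = 2 * \<i> * (2 * \<i>) ^ (m - 1)"
    using assms(2) by (cases m) simp_all
  show ?thesis
    unfolding L_def[symmetric] step W_def[symmetric] dd hs pr pw using nz by (simp add: field_simps)
qed

section \<open>Marsden's identity\<close>

text \<open>The next two lemmas turn the counting hypotheses of the theorem into index bounds: \<open>m\<close> indices
  on one side of a gap in a set without holes force the \<open>m\<close> indices nearest to the gap to belong
  to it.\<close>

lemma interval_set_contains_below:
  fixes J :: "int set"
  assumes J: "\<forall>a\<in>J. \<forall>b\<in>J. {a..b} \<subseteq> J" and "p \<in> J" "m \<ge> 1" "A \<subseteq> J" "\<And>j. j \<in> A \<Longrightarrow> j \<le> p"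
    and "infinite A \<or> m \<le> card A"
  shows "p - int m + 1 \<in> J"
proof -
  have "\<not> A \<subseteq> {p - int m + 2..p}"
  proof
    assume sub: "A \<subseteq> {p - int m + 2..p}"
    then have "finite A" by (rule finite_subset) simp
    moreover have "card A \<le> m - 1" using card_mono[OF _ sub] by simp
    ultimately show False using assms(3,6) by simp
  qed
  then obtain a where a: "a \<in> A" "a < p - int m + 2" using assms(5) by force
  then have "p - int m + 1 \<in> {a..p}" using assms(3) by auto
  then show ?thesis using J a(1) assms(2,4) by blast
qed

lemma interval_set_contains_above:
  fixes J :: "int set"
  assumes J: "\<forall>a\<in>J. \<forall>b\<in>J. {a..b} \<subseteq> J" and "p \<in> J" "m \<ge> 1" "A \<subseteq> J" "\<And>j. j \<in> A \<Longrightarrow> p < j"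
    and "infinite A \<or> m \<le> card A"
  shows "p + int m \<in> J"
proof -
  have "\<not> A \<subseteq> {p + 1..p + int m - 1}"
  proof
    assume sub: "A \<subseteq> {p + 1..p + int m - 1}"
    then have "finite A" by (rule finite_subset) simp
    moreover have "card A \<le> m - 1" using card_mono[OF _ sub] by simp
    ultimately show False using assms(3,6) by simp
  qed
  then obtain a where a: "a \<in> A" "a > p + int m - 1" using assms(5) by force
  then have "p + int m \<in> {p..a}" using assms(3) by auto
  then show ?thesis using J a(1) assms(2,4) by blast
qed

lemma isCont_hsin: "isCont (hsin h) a"
  unfolding hsin_def hexp_def by (intro continuous_intros) auto

text \<open>The core of the theorem, for the \<open>m\<close> splines that can be nonzero at \<open>x\<close>. For the lowered, distinct
  knots the sum telescopes; the same sequence of lowered knots is an admissible approach for every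
  spline, so both sides converge to the assertion.\<close>

lemma finite_marsden_identity:
  fixes \<xi> :: "int \<Rightarrow> real"
  assumes h: "h \<noteq> 0" "h > -1" and m: "m \<ge> 1"
    and mono: "mono_on {p - int m + 1..p + int m} \<xi>"
    and spread: "\<And>j. j \<in> {p - int m + 1..p} \<Longrightarrow>
        0 < \<xi> (j + int m) - \<xi> j \<and> \<xi> (j + int m) - \<xi> j < 2 * pi * h / ln (1 + h)"
    and x: "\<xi> p \<le> x" "x < \<xi> (p + 1)"
  shows "(\<Sum>j = p - int m + 1..p. T_spline_normalized \<xi> j m x h *
            (\<Prod>l=1..m-1. hsin h ((y - \<xi> (j + int l)) / 2))) = hsin_power h (m - 1) x y"
proof -
  define f where "f = hsin_trunc_power h (m - 1) x"
  define s where "s n j = lowered (p + int m) \<xi> n j" for n j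
  define D where "D n j = hsin h ((s n (j + int m) - s n j) / 2) *
      divdiff_distinct m (\<lambda>i. s n (j + int i)) h f * (\<Prod>l=1..m-1. hsin h ((y - s n (j + int l)) / 2))" for n j
  have window: "mono_on {..m} (\<lambda>i. \<xi> (j + int i))" if "j \<in> {p - int m + 1..p}" for j
    by (rule mono_onI, rule mono_onD[OF mono]) (use that in auto)
  have approach: "filterlim (\<lambda>n i. s n (j + int i)) (from_below m (\<lambda>i. \<xi> (j + int i))) sequentially"
    if "j \<in> {p - int m + 1..p}" for j
    unfolding s_def using that by (intro lowered_from_below mono_on_subset[OF mono]) auto
  have s_lim: "(\<lambda>n. s n j) \<longlonglongrightarrow> \<xi> j" for j
    unfolding s_def by (rule lowered_tendsto)
  have "(\<lambda>n. \<Sum>j = p - int m + 1..p. D n j) \<longlonglongrightarrow>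
     (\<Sum>j = p - int m + 1..p. T_spline_normalized \<xi> j m x h *
            (\<Prod>l=1..m-1. hsin h ((y - \<xi> (j + int l)) / 2)))"
  proof (rule tendsto_sum)
    fix j assume j: "j \<in> {p - int m + 1..p}"
    have "(\<lambda>n. divdiff_distinct m (\<lambda>i. s n (j + int i)) h f) \<longlonglongrightarrow> divdiff m (\<lambda>i. \<xi> (j + int i)) h f"
      unfolding f_def
      by (rule filterlim_compose[OF divdiff_trunc_power_tendsto[OF h m window[OF j]] approach[OF j]])
        (use spread[OF j] in simp)
    moreover have "T_spline \<xi> j m x h = divdiff m (\<lambda>i. \<xi> (j + int i)) h f"
      using spread[OF j] by (simp add: T_spline_def f_def)
    ultimately show "(\<lambda>n. D n j) \<longlonglongrightarrow> T_spline_normalized \<xi> j m x h *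
            (\<Prod>l=1..m-1. hsin h ((y - \<xi> (j + int l)) / 2))"
      unfolding D_def T_spline_normalized_def
      by (intro tendsto_mult tendsto_prod isCont_tendsto_compose[OF isCont_hsin] tendsto_intros s_lim) auto
  qed
  moreover have "(\<lambda>n. \<Sum>j = p - int m + 1..p. D n j) \<longlonglongrightarrow> hsin_power h (m - 1) x y"
  proof (rule tendsto_eventually)
    have "\<forall>\<^sub>F n in sequentially. \<forall>j\<in>{p - int m + 1..p}. inj_on (\<lambda>i. hexp h (s n (j + int i))) {..m}"
    proof (intro eventually_ball_finite ballI)
      fix j assume j: "j \<in> {p - int m + 1..p}"
      have "\<forall>\<^sub>F t in from_below m (\<lambda>i. \<xi> (j + int i)). inj_on (\<lambda>i. hexp h (t i)) {..m}"
        by (rule eventually_mono[OF eventually_divdiff_distinct_trunc_power[OF h m]])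
          (use spread[OF j] in auto)
      then show "\<forall>\<^sub>F n in sequentially. inj_on (\<lambda>i. hexp h (s n (j + int i))) {..m}"
        using approach[OF j] by (rule eventually_compose_filterlim)
    qed simp
    moreover have "\<forall>\<^sub>F n in sequentially. \<forall>j\<in>{p + 1..p + int m}. x < s n j"
    proof (intro eventually_ball_finite ballI)
      fix j assume j: "j \<in> {p + 1..p + int m}"
      have "\<xi> (p + 1) \<le> \<xi> j" using j by (intro mono_onD[OF mono]) auto
      then show "\<forall>\<^sub>F n in sequentially. x < s n j"
        using x by (intro order_tendstoD(1)[OF s_lim]) auto
    qed simp
    ultimately show "\<forall>\<^sub>F n in sequentially. (\<Sum>j = p - int m + 1..p. D n j) = hsin_power h (m - 1) x y"
    proof eventually_elim
      case (elim n)
      define L where "L j = poly (hinterpolant h m f (\<lambda>i. s n (j + int i))) (hexp h y) / hexp h (y / 2) ^ (m - 1)" for j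
      have "D n j = L (j + 1) - L j" if "j \<in> {p - int m + 1..p}" for j
        using divdiff_distinct_telescopes[of h "\<lambda>i. s n (j + int i)" m f y] elim that m
        by (simp add: D_def L_def diff_divide_distrib add.assoc)
      then have "(\<Sum>j = p - int m + 1..p. D n j) = (\<Sum>j = p - int m + 1..p. L (j + 1) - L j)"
        by simp
      also have "\<dots> = (\<Sum>i<m. L (p - int m + 1 + int (Suc i)) - L (p - int m + 1 + int i))"
        by (rule sum.reindex_bij_witness[of _ "\<lambda>i. p - int m + 1 + int i" "\<lambda>j. nat (j - (p - int m + 1))"])
          (use m in \<open>auto simp: algebra_simps\<close>)
      also have "\<dots> = L (p - int m + 1 + int m) - L (p - int m + 1 + int 0)"
        by (rule sum_lessThan_telescope)
      also have "\<dots> = L (p + 1) - L (p - int m + 1)"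
        by (simp add: algebra_simps)
      \<comment> \<open>The truncated power vanishes at every node of the leftmost window.\<close>
      also have "L (p - int m + 1) = 0"
      proof -
        have "f (s n (p - int m + 1 + int i)) = 0" if "i < m" for i
        proof -
          have "s n (p - int m + 1 + int i) \<le> \<xi> (p - int m + 1 + int i)"
            unfolding s_def using that by (intro lowered_le) auto
          also have "\<dots> \<le> \<xi> p" using that by (intro mono_onD[OF mono]) auto
          finally show ?thesis using x by (simp add: f_def hsin_trunc_power_def)
        qed
        then show ?thesis by (simp add: L_def hinterpolant_def poly_lagrange)
      qed
      \<comment> \<open>On the rightmost window it is a polynomial of degree less than \<open>m\<close>, hence its own interpolant.\<close>
      also have "L (p + 1) = hsin_power h (m - 1) x y"
      proof -
        have "hinterpolant h m f (\<lambda>i. s n (p + 1 + int i)) = hpower_poly h (m - 1) x"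
          unfolding hinterpolant_def
        proof (rule lagrange_unique)
          have "inj_on (\<lambda>i. hexp h (s n (p + int i))) (Suc ` {..<m})"
            by (rule inj_on_subset[of _ "{..m}"]) (use elim m in auto)
          then show "inj_on (\<lambda>i. hexp h (s n (p + 1 + int i))) {..<m}"
            by (auto simp: inj_on_def algebra_simps)
          show "degree (hpower_poly h (m - 1) x) < card {..<m}"
            using degree_hpower_poly[of h "m - 1" x] m by simp
          fix i assume "i \<in> {..<m}"
          then have "x < s n (p + 1 + int i)" using elim by auto
          then show "f (s n (p + 1 + int i)) * hexp h (s n (p + 1 + int i) / 2) ^ (m - 1) =
              poly (hpower_poly h (m - 1) x) (hexp h (s n (p + 1 + int i)))"
            by (simp add: f_def hsin_trunc_power_def poly_hpower_poly)
        qed simp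
        then show ?thesis by (simp add: L_def poly_hpower_poly)
      qed
      finally show ?case by simp
    qed
  qed
  ultimately show ?thesis by (rule LIMSEQ_unique)
qed

text \<open>Choose \<open>p\<close> with \<open>x\<^sub>p \<le> x < x\<^sub>p\<^sub>+\<^sub>1\<close>. Splines with other indices than \<open>p - m + 1, \<dots>, p\<close> vanish at \<open>x\<close>, so a
  possibly infinite sum reduces to these \<open>m\<close> terms.\<close>

theorem theorem5p8:
  fixes h x y :: real and m :: nat and J :: "int set" and \<xi> :: "int \<Rightarrow> real" and k r :: int
  assumes "h \<noteq> 0" and "h > -1" and "m \<ge> 1"
    and "\<forall>a\<in>J. \<forall>b\<in>J. {a..b} \<subseteq> J"
    and "mono_on J \<xi>"
    and "\<forall>j. j \<in> J \<and> j + int m \<in> J \<longrightarrow>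
           0 < \<xi> (j + int m) - \<xi> j \<and> \<xi> (j + int m) - \<xi> j < 2 * pi * h / ln (1 + h)"
    and "k \<in> J" and "r \<in> J" and "\<xi> k < \<xi> r"
    and "infinite {j\<in>J. \<xi> j \<le> \<xi> k} \<or> m \<le> card {j\<in>J. \<xi> j \<le> \<xi> k}"
    and "infinite {j\<in>J. \<xi> j \<ge> \<xi> r} \<or> m \<le> card {j\<in>J. \<xi> j \<ge> \<xi> r}"
    and "x \<in> {\<xi> k<..<\<xi> r}"
  shows "((\<lambda>j. T_spline_normalized \<xi> j m x h *
              (\<Prod>l=1..m-1. hsin h ((y - \<xi> (j + int l)) / 2)))
          has_sum hsin_power h (m - 1) x y) {j. j \<in> J \<and> j + int m \<in> J}"
proof -
  let ?F = "\<lambda>j. T_spline_normalized \<xi> j m x h * (\<Prod>l=1..m-1. hsin h ((y - \<xi> (j + int l)) / 2))"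
  have mono: "\<xi> i \<le> \<xi> j" if "i \<in> J" "j \<in> J" "i \<le> j" for i j
    using mono_onD[OF assms(5)] that by blast
  have "k < r" using mono[of r k] assms(7-9) by (meson leD linorder_le_less_linear)
  define P where "P = {j\<in>{k..r}. \<xi> j \<le> x}"
  have P: "finite P" "k \<in> P"
    using \<open>k < r\<close> assms(12) by (auto simp: P_def intro: finite_subset[of _ "{k..r}"])
  define p where "p = Max P"
  have "p \<in> P" unfolding p_def using P by (intro Max_in) auto
  then have p: "k \<le> p" "p < r" "\<xi> p \<le> x" using assms(12) by (auto simp: P_def order_le_less)
  have "p + 1 \<notin> P" using Max_ge[OF P(1), of "p + 1"] by (auto simp: p_def)
  then have p': "x < \<xi> (p + 1)" using p by (auto simp: P_def)
  have pJ: "p \<in> J" "p + 1 \<in> J" 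
  proof -
    have "{k..r} \<subseteq> J" using assms(4,7,8) by blast
    then show "p \<in> J" "p + 1 \<in> J" using p by auto
  qed
  have left: "\<xi> j \<le> x \<longleftrightarrow> j \<le> p" if "j \<in> J" for j
    using mono[of j p] mono[of "p + 1" j] that pJ p p' by (cases "j \<le> p") auto
  have low: "p - int m + 1 \<in> J"
    by (rule interval_set_contains_below[OF assms(4) pJ(1) assms(3) _ _ assms(10)])
      (use left assms(12) in fastforce)+
  have high: "p + int m \<in> J"
    by (rule interval_set_contains_above[OF assms(4) pJ(1) assms(3) _ _ assms(11)])
      (use left assms(12) in fastforce)+
  have J: "{p - int m + 1..p + int m} \<subseteq> J" using assms(4) low high by blast
  let ?I = "{p - int m + 1..p}"
  have IJ: "j \<in> J \<and> j + int m \<in> J" if "j \<in> ?I" for j using that J by auto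
  have zero: "?F j = 0" if j: "j \<in> J" "j + int m \<in> J" "j \<notin> ?I" for j
  proof -
    have "x < \<xi> (j + int 0) \<or> \<xi> (j + int m) \<le> x"
      using j left[of j] left[of "j + int m"] by auto
    moreover have "mono_on {..m} (\<lambda>i. \<xi> (j + int i))"
    proof (rule mono_onI)
      fix i i' assume "i \<in> {..m}" "i' \<in> {..m}" "i \<le> i'"
      then have "j + int i \<in> {j..j + int m}" "j + int i' \<in> {j..j + int m}" by auto
      then have "j + int i \<in> J" "j + int i' \<in> J" using assms(4) j by blast+
      then show "\<xi> (j + int i) \<le> \<xi> (j + int i')" using \<open>i \<le> i'\<close> by (intro mono) auto
    qed
    ultimately have "divdiff m (\<lambda>i. \<xi> (j + int i)) h (hsin_trunc_power h (m - 1) x) = 0"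
      using assms(6) j by (intro divdiff_trunc_power_outside assms(1-3)) auto
    then show ?thesis by (simp add: T_spline_normalized_def T_spline_def)
  qed
  have "(?F has_sum (\<Sum>j\<in>?I. ?F j)) ?I"
    by (rule has_sum_finite) simp
  also have "(\<Sum>j\<in>?I. ?F j) = hsin_power h (m - 1) x y"
    by (rule finite_marsden_identity[OF assms(1-3) mono_on_subset[OF assms(5) J] _ p(3) p'])
      (use assms(6) IJ in blast)
  also have "(?F has_sum hsin_power h (m - 1) x y) ?I \<longleftrightarrow>
      (?F has_sum hsin_power h (m - 1) x y) {j. j \<in> J \<and> j + int m \<in> J}"
    by (rule has_sum_cong_neutral) (use zero IJ in auto)
  finally show ?thesis .
qed

end
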